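(* Let $q>32/27$ be a real number. Then for every $\varepsilon>0$ there exist $q'\in\mathbb{C}$ with $|q'-q|<\varepsilon$ and a series-parallel graph $G$ such that $Z(G;q')=0$.
   Context: The chromatic polynomial of a finite graph $G=(V,E)$ (multiple edges allowed) is $Z(G;q)=\sum_{F\subseteq E}(-1)^{|F|}q^{k(F)}$, where $k(F)$ is the number of connected components of the graph $(V,F)$. A two-terminal graph is a graph with a designated start vertex $s$ and a designated end vertex $t$. Let $G_1,G_2$ be two-terminal graphs with terminals $s_1,t_1$ and $s_2,t_2$. Their parallel composition $G_1\parallel G_2$ is obtained from the disjoint union by identifying $s_1$ with $s_2$ into a single vertex $s$ and $t_1$ with $t_2$ into a single vertex $t$, with terminals $s,t$. Their series composition $G_1\bowtie G_2$ is obtained from the disjoint union by identifying $t_1$ with $s_2$, with start vertex $s=s_1$ and end vertex $t=t_2$. A two-terminal graph is series-parallel if it can be obtained from a single edge $K_2$ (whose two endpoints are the terminals) using series and parallel compositions. *)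

theory Defs
  imports Complex_Main
begin

text \<open>Undirected multigraphs: every edge has a set of endpoints. The value of \<open>ends\<close> outside
  \<open>edges\<close> is irrelevant.\<close>

record ('v, 'e) multigraph =
  verts :: "'v set"
  edges :: "'e set"
  ends :: "'e \<Rightarrow> 'v set"

definition finite_multigraph :: "('v, 'e, 'x) multigraph_scheme \<Rightarrow> bool" where
  "finite_multigraph G \<longleftrightarrow> finite (verts G) \<and> finite (edges G) \<and>
     (\<forall>e\<in>edges G. ends G e \<subseteq> verts G \<and> card (ends G e) = 2)"

definition adjacency :: "('v, 'e, 'x) multigraph_scheme \<Rightarrow> 'e set \<Rightarrow> 'v rel" where
  "adjacency G F = {(u, v). \<exists>e\<in>F. ends G e = {u, v}}"

definition connected_in :: "('v, 'e, 'x) multigraph_scheme \<Rightarrow> 'e set \<Rightarrow> 'v rel" where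
  "connected_in G F = (adjacency G F)\<^sup>* \<inter> verts G \<times> verts G"

definition num_components :: "('v, 'e, 'x) multigraph_scheme \<Rightarrow> 'e set \<Rightarrow> nat" where
  "num_components G F = card (verts G // connected_in G F)"

definition chromatic :: "('v, 'e, 'x) multigraph_scheme \<Rightarrow> 'a::comm_ring_1 \<Rightarrow> 'a" where
  "chromatic G q = (\<Sum>F\<in>Pow (edges G). (-1) ^ card F * q ^ num_components G F)"

record ('v, 'e) two_terminal = "('v, 'e) multigraph" +
  start_vertex :: 'v
  end_vertex :: 'v

definition two_terminal_graph :: "('v, 'e) two_terminal \<Rightarrow> bool" where
  "two_terminal_graph G \<longleftrightarrow> finite_multigraph G \<and>
     start_vertex G \<in> verts G \<and> end_vertex G \<in> verts G \<and> start_vertex G \<noteq> end_vertex G"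

definition disjoint_union ::
  "('v, 'e, 'x) multigraph_scheme \<Rightarrow> ('w, 'f, 'y) multigraph_scheme \<Rightarrow> ('v + 'w, 'e + 'f) multigraph"
  where
  "disjoint_union G H =
     \<lparr>verts = verts G <+> verts H,
      edges = edges G <+> edges H,
      ends = case_sum (\<lambda>e. Inl ` ends G e) (\<lambda>e. Inr ` ends H e)\<rparr>"

text \<open>Vertices are identified by applying a map \<open>f\<close> that sends each vertex to the chosen
  representative of its class; edges (including parallel ones) are kept.\<close>

definition identify :: "('v \<Rightarrow> 'v) \<Rightarrow> ('v, 'e) multigraph \<Rightarrow> ('v, 'e) multigraph" where
  "identify f G = \<lparr>verts = f ` verts G, edges = edges G, ends = (\<lambda>e. f ` ends G e)\<rparr>"

text \<open>The simultaneous update below is the intended identification because the two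
  terminals of each graph are distinct.\<close>

definition parallel ::
  "('v, 'e) two_terminal \<Rightarrow> ('w, 'f) two_terminal \<Rightarrow> ('v + 'w, 'e + 'f) two_terminal" where
  "parallel G H =
     multigraph.extend
       (identify (id(Inr (start_vertex H) := Inl (start_vertex G),
                     Inr (end_vertex H) := Inl (end_vertex G)))
         (disjoint_union G H))
       (two_terminal.fields (Inl (start_vertex G)) (Inl (end_vertex G)))"

definition series ::
  "('v, 'e) two_terminal \<Rightarrow> ('w, 'f) two_terminal \<Rightarrow> ('v + 'w, 'e + 'f) two_terminal" where
  "series G H =
     multigraph.extend
       (identify (id(Inr (start_vertex H) := Inl (end_vertex G))) (disjoint_union G H))
       (two_terminal.fields (Inl (start_vertex G)) (Inr (end_vertex H)))"

definition isomorphic :: "('v, 'e) two_terminal \<Rightarrow> ('w, 'f) two_terminal \<Rightarrow> bool" where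
  "isomorphic G H \<longleftrightarrow>
     (\<exists>f g. bij_betw f (verts G) (verts H) \<and> bij_betw g (edges G) (edges H) \<and>
        (\<forall>e\<in>edges G. ends H (g e) = f ` ends G e) \<and>
        f (start_vertex G) = start_vertex H \<and> f (end_vertex G) = end_vertex H)"

definition is_K2 :: "('v, 'e) two_terminal \<Rightarrow> bool" where
  "is_K2 G \<longleftrightarrow> start_vertex G \<noteq> end_vertex G \<and> verts G = {start_vertex G, end_vertex G} \<and>
     (\<exists>e. edges G = {e} \<and> ends G e = {start_vertex G, end_vertex G})"

text \<open>The compositions change the types of vertices and edges, so the class is taken up to
  isomorphism; every finite graph has a copy on the natural numbers.\<close>

inductive series_parallel :: "(nat, nat) two_terminal \<Rightarrow> bool" where
  K2: "is_K2 G \<Longrightarrow> series_parallel G"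
| parallel: "\<lbrakk>series_parallel G; series_parallel H; isomorphic (parallel G H) K\<rbrakk> \<Longrightarrow> series_parallel K"
| series: "\<lbrakk>series_parallel G; series_parallel H; isomorphic (series G H) K\<rbrakk> \<Longrightarrow> series_parallel K"

lemma parallel_simps [simp]:
  fixes G H
  defines "f \<equiv> id(Inr (start_vertex H) := Inl (start_vertex G),
                     Inr (end_vertex H) := Inl (end_vertex G))"
  shows "verts (parallel G H) = f ` (verts G <+> verts H)"
    "edges (parallel G H) = edges G <+> edges H"
    "ends (parallel G H) (Inl e) = f ` Inl ` ends G e"
    "ends (parallel G H) (Inr e') = f ` Inr ` ends H e'"
    "start_vertex (parallel G H) = Inl (start_vertex G)"
    "end_vertex (parallel G H) = Inl (end_vertex G)"
  by (simp_all add: f_def parallel_def identify_def disjoint_union_def multigraph.defs two_terminal.defs)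

lemma series_simps [simp]:
  fixes G H
  defines "f \<equiv> id(Inr (start_vertex H) := Inl (end_vertex G))"
  shows "verts (series G H) = f ` (verts G <+> verts H)"
    "edges (series G H) = edges G <+> edges H"
    "ends (series G H) (Inl e) = f ` Inl ` ends G e"
    "ends (series G H) (Inr e') = f ` Inr ` ends H e'"
    "start_vertex (series G H) = Inl (start_vertex G)"
    "end_vertex (series G H) = Inr (end_vertex H)"
  by (simp_all add: f_def series_def identify_def disjoint_union_def multigraph.defs two_terminal.defs)

lemma two_terminal_graph_parallel:
  assumes G: "two_terminal_graph G" and H: "two_terminal_graph H"
  shows "two_terminal_graph (parallel G H)"
proof -
  let ?f = "id(Inr (start_vertex H) := Inl (start_vertex G), Inr (end_vertex H) := Inl (end_vertex G))"
  have i: "inj_on ?f (range Inl)" "inj_on ?f (range Inr)"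
    using G H by (auto simp: inj_on_def two_terminal_graph_def)
  have c: "card (?f ` Inl ` A) = card A" "card (?f ` Inr ` B) = card B" for A B
    by (subst card_image, rule inj_on_subset[OF i(1)], blast, simp add: card_image,
        subst card_image, rule inj_on_subset[OF i(2)], blast, simp add: card_image)
  have s: "start_vertex (parallel G H) \<in> verts (parallel G H)"
    "end_vertex (parallel G H) \<in> verts (parallel G H)"
    using G by (auto simp: two_terminal_graph_def intro!: image_eqI[where x = "Inl _"])
  have e: "ends (parallel G H) x \<subseteq> verts (parallel G H) \<and> card (ends (parallel G H) x) = 2"
    if "x \<in> edges G <+> edges H" for x
  proof (cases x)
    case (Inl y)
    then have y: "ends G y \<subseteq> verts G" "card (ends G y) = 2"
      using that G by (auto simp: two_terminal_graph_def finite_multigraph_def)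
    have "Inl ` ends G y \<subseteq> verts G <+> verts H" using y(1) by auto
    then show ?thesis unfolding Inl parallel_simps(1,3) c y(2) by (blast intro: image_mono)
  next
    case (Inr y)
    then have y: "ends H y \<subseteq> verts H" "card (ends H y) = 2"
      using that H by (auto simp: two_terminal_graph_def finite_multigraph_def)
    have "Inr ` ends H y \<subseteq> verts G <+> verts H" using y(1) by auto
    then show ?thesis unfolding Inr parallel_simps(1,4) c y(2) by (blast intro: image_mono)
  qed
  have fin: "finite (verts (parallel G H))" "finite (edges G <+> edges H)"
    using G H unfolding parallel_simps(1) two_terminal_graph_def finite_multigraph_def
    by (blast intro: finite_imageI finite_Plus)+
  have d: "start_vertex (parallel G H) \<noteq> end_vertex (parallel G H)"
    using G H by (simp add: two_terminal_graph_def)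
  show ?thesis
    unfolding two_terminal_graph_def finite_multigraph_def
    using s d e fin unfolding parallel_simps(2) by blast
qed

lemma two_terminal_graph_series:
  assumes G: "two_terminal_graph G" and H: "two_terminal_graph H"
  shows "two_terminal_graph (series G H)"
proof -
  let ?f = "id(Inr (start_vertex H) := Inl (end_vertex G))"
  have i: "inj_on ?f (range Inl)" "inj_on ?f (range Inr)"
    using G H by (auto simp: inj_on_def two_terminal_graph_def)
  have c: "card (?f ` Inl ` A) = card A" "card (?f ` Inr ` B) = card B" for A B
    by (subst card_image, rule inj_on_subset[OF i(1)], blast, simp add: card_image,
        subst card_image, rule inj_on_subset[OF i(2)], blast, simp add: card_image)
  have s: "start_vertex (series G H) \<in> verts (series G H)"
    using G by (auto simp: two_terminal_graph_def intro!: image_eqI[where x = "Inl _"])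
  have t: "end_vertex (series G H) \<in> verts (series G H)"
    using H by (auto simp: two_terminal_graph_def intro!: image_eqI[where x = "Inr _"])
  have e: "ends (series G H) x \<subseteq> verts (series G H) \<and> card (ends (series G H) x) = 2"
    if "x \<in> edges G <+> edges H" for x
  proof (cases x)
    case (Inl y)
    then have y: "ends G y \<subseteq> verts G" "card (ends G y) = 2"
      using that G by (auto simp: two_terminal_graph_def finite_multigraph_def)
    have "Inl ` ends G y \<subseteq> verts G <+> verts H" using y(1) by auto
    then show ?thesis unfolding Inl series_simps(1,3) c y(2) by (blast intro: image_mono)
  next
    case (Inr y)
    then have y: "ends H y \<subseteq> verts H" "card (ends H y) = 2"
      using that H by (auto simp: two_terminal_graph_def finite_multigraph_def)
    have "Inr ` ends H y \<subseteq> verts G <+> verts H" using y(1) by auto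
    then show ?thesis unfolding Inr series_simps(1,4) c y(2) by (blast intro: image_mono)
  qed
  have fin: "finite (verts (series G H))" "finite (edges G <+> edges H)"
    using G H unfolding series_simps(1) two_terminal_graph_def finite_multigraph_def
    by (blast intro: finite_imageI finite_Plus)+
  have d: "start_vertex (series G H) \<noteq> end_vertex (series G H)"
    using G H by (simp add: two_terminal_graph_def)
  show ?thesis
    unfolding two_terminal_graph_def finite_multigraph_def
    using s t d e fin unfolding series_simps(2) by blast
qed

lemma two_terminal_graph_isomorphic:
  assumes "two_terminal_graph G" "isomorphic G H"
  shows "two_terminal_graph H"
proof -
  obtain f g where f: "bij_betw f (verts G) (verts H)" and g: "bij_betw g (edges G) (edges H)"
    and e: "\<forall>e\<in>edges G. ends H (g e) = f ` ends G e"
    and st: "f (start_vertex G) = start_vertex H" "f (end_vertex G) = end_vertex H"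
    using assms(2) by (auto simp: isomorphic_def)
  have G: "finite (verts G)" "finite (edges G)"
    "\<And>e. e \<in> edges G \<Longrightarrow> ends G e \<subseteq> verts G \<and> card (ends G e) = 2"
    "start_vertex G \<in> verts G" "end_vertex G \<in> verts G" "start_vertex G \<noteq> end_vertex G"
    using assms(1) by (auto simp: two_terminal_graph_def finite_multigraph_def)
  have inj: "inj_on f (verts G)" and im: "f ` verts G = verts H" "g ` edges G = edges H"
    using f g by (auto simp: bij_betw_def)
  have "ends H e' \<subseteq> verts H \<and> card (ends H e') = 2" if e': "e' \<in> edges H" for e'
  proof -
    obtain d where d: "d \<in> edges G" "e' = g d" using e' im(2) by blast
    have "card (f ` ends G d) = 2" using G(3)[OF d(1)] card_image[OF inj_on_subset[OF inj]] by simp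
    moreover have "f ` ends G d \<subseteq> verts H" using G(3)[OF d(1)]
      unfolding im(1)[symmetric] by (intro image_mono) simp
    ultimately show ?thesis using d e by simp
  qed
  moreover have "finite (verts H)" "finite (edges H)" using G(1,2) by (simp_all flip: im)
  moreover have "start_vertex H \<in> verts H" "end_vertex H \<in> verts H" using G(4,5) by (simp_all flip: im st)
  moreover have "start_vertex H \<noteq> end_vertex H" using G(4-6) inj by (simp add: inj_on_eq_iff flip: st)
  ultimately show ?thesis unfolding two_terminal_graph_def finite_multigraph_def by blast
qed

lemma series_parallel_two_terminal_graph:
  "series_parallel G \<Longrightarrow> two_terminal_graph G"
proof (induction rule: series_parallel.induct)
  case (K2 G)
  then show ?case by (auto simp: is_K2_def two_terminal_graph_def finite_multigraph_def)
next
  case (parallel G H K)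
  show ?case
    by (rule two_terminal_graph_isomorphic[OF two_terminal_graph_parallel[OF parallel.IH] parallel.hyps(3)])
next
  case (series G H K)
  show ?case
    by (rule two_terminal_graph_isomorphic[OF two_terminal_graph_series[OF series.IH] series.hyps(3)])
qed

lemma chromatic_K2:
  assumes "is_K2 G"
  shows "chromatic G q = q ^ 2 - q"
proof -
  obtain s t e where st: "s \<noteq> t" "verts G = {s, t}" "edges G = {e}" "ends G e = {s, t}"
    using assms by (auto simp: is_K2_def)
  have "adjacency G {} = {}" by (auto simp: adjacency_def)
  then have "connected_in G {} = {(s, s), (t, t)}" using st by (auto simp: connected_in_def)
  then have 0: "num_components G {} = 2" using st by (simp add: num_components_def quotient_def Image_def)
  have "(s, t) \<in> adjacency G {e}" "(t, s) \<in> adjacency G {e}" using st by (auto simp: adjacency_def)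
  then have "connected_in G {e} = {s, t} \<times> {s, t}" using st by (auto simp: connected_in_def)
  then have 1: "num_components G {e} = 1" using st by (simp add: num_components_def quotient_def Image_def)
  have "Pow (edges G) = {{}, {e}}" using st by auto
  then show ?thesis using 0 1 by (simp add: chromatic_def)
qed

end

theory Submission
  imports Defs "HOL-Complex_Analysis.Complex_Analysis"
begin

text \<open>For a two-terminal graph \<open>G\<close>, let \<open>b(n)\<close> and \<open>a(n)\<close> count the proper \<open>n\<close>-colourings in which the
  terminals get a prescribed common colour, respectively two prescribed different colours. For
  series-parallel graphs both are polynomials in \<open>n\<close>, and the chromatic polynomial is
  \<open>q (b(q) + (q - 1) a(q))\<close>. So a point with \<open>a(q) \<noteq> 0\<close> is a chromatic root as soon as the
  \<^emph>\<open>interaction\<close> \<open>y = b / a\<close> equals \<open>1 - q\<close>. Parallel composition multiplies interactions; series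
  composition sends \<open>y\<^sub>1, y\<^sub>2\<close> to \<open>(y\<^sub>1 y\<^sub>2 + q - 1) / (y\<^sub>1 + y\<^sub>2 + q - 2)\<close>; a single edge has \<open>y = 0\<close>.

  \<^bold>\<open>Reduction to one expanding graph.\<close> Suppose that at a real point \<open>x > 1\<close> two series-parallel graphs
  have real interactions with \<open>0 < \<bar>y\<^sub>1\<bar> < 1 < \<bar>y\<^sub>2\<bar>\<close>. Composing \<open>2n\<close> copies of the first and \<open>2m\<close> copies of
  the second in parallel turns the root condition into \<open>n U + m V = w\<close> with \<open>U = Ln y\<^sub>1\<^sup>2\<close>,
  \<open>V = Ln y\<^sub>2\<^sup>2\<close> and \<open>w\<close> a logarithm of \<open>1 - z\<close>. Choose \<open>m\<close> so that \<open>m / n\<close> tends to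
  \<open>- U(x) / V(x)\<close>. After division by \<open>n\<close> the equation converges to \<open>U - (U(x) / V(x)) V = 0\<close>, which is
  solved by \<open>x\<close>; if the limit function is not constant, Hurwitz's theorem gives solutions near \<open>x\<close>
  (\<open>integer_combination_solution\<close>). The paths with two and three edges have logarithmic
  derivatives that are not proportional on any open set, so the limit function is nonconstant for at least
  one of them when the partner is fixed. The path with three edges always has \<open>\<bar>y\<bar> < 1\<close>, hence a single
  graph with real interaction of modulus greater than 1 is enough
  (\<open>chromatic_roots_near_expanding_point\<close>).

  \<^bold>\<open>Where 32/27 enters.\<close> If \<open>x > 2\<close>, the path with two edges has \<open>y = (x - 1) / (x - 2) > 1\<close>. If
  \<open>32/27 < x < 2\<close>, start from a single edge and repeatedly replace a graph by two copies in parallel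
  and that by two copies in series. The interaction changes by the map
  \<open>T(y) = 1 + (1 - y\<^sup>2)\<^sup>2 / (x - 2 (1 - y\<^sup>2))\<close>, and
  \<open>T(y) - y = (1 - y) (x - (1 - y)\<^sup>2 (1 + y)) / (x - 2 (1 - y\<^sup>2))\<close>. The maximum of \<open>(1 - y)\<^sup>2 (1 + y)\<close>
  on \<open>[-1, 0]\<close> is \<open>32/27\<close>, attained at \<open>y = -1/3\<close>. So beyond \<open>32/27\<close> the orbit of 0 meets no fixed point:
  it decreases by a definite amount at each step while the denominator is negative, and as soon as the
  denominator is positive the next value is greater than 1. Either way the orbit leaves \<open>[-1, 1]\<close>
  (\<open>interaction_orbit_escapes\<close>). Poles of the orbit and the value \<open>-1\<close> occur at countably many \<open>x\<close> only
  and are avoided by moving \<open>x\<close> slightly.\<close>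

section \<open>Proper colourings and the chromatic polynomial\<close>

definition colourings :: "('v, 'e, 'x) multigraph_scheme \<Rightarrow> nat \<Rightarrow> ('v \<Rightarrow> nat) set" where
  "colourings G n =
     {c \<in> verts G \<rightarrow>\<^sub>E {..<n}. \<forall>e\<in>edges G. \<not> c constant_on ends G e}"

text \<open>A colouring that is constant along the edges of \<open>F\<close> is a function on the components of \<open>(V, F)\<close>.\<close>

lemma card_constant_on_edges:
  assumes G: "finite_multigraph G" and F: "F \<subseteq> edges G"
  shows "card {c \<in> verts G \<rightarrow>\<^sub>E {..<n::nat}. \<forall>e\<in>F. c constant_on ends G e} = n ^ num_components G F"
proof -
  let ?R = "connected_in G F"
  let ?A = "{c \<in> verts G \<rightarrow>\<^sub>E {..<n}. \<forall>e\<in>F. c constant_on ends G e}"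
  have symadj: "sym (adjacency G F)"
    by (auto simp: sym_def adjacency_def insert_commute)
  have equiv: "equiv (verts G) ?R"
  proof (rule equivI)
    show "?R \<subseteq> verts G \<times> verts G" by (auto simp: connected_in_def)
    show "refl_on (verts G) ?R" by (auto simp: refl_on_def connected_in_def)
    show "sym ?R" using sym_rtrancl[OF symadj] by (auto simp: sym_def connected_in_def)
    show "trans ?R" by (auto simp: trans_def connected_in_def)
  qed
  have pair: "\<exists>u v. ends G e = {u, v} \<and> u \<in> verts G \<and> v \<in> verts G" if "e \<in> F" for e
  proof -
    have "ends G e \<subseteq> verts G" "card (ends G e) = 2"
      using that G F by (auto simp: finite_multigraph_def)
    then show ?thesis by (auto simp: card_2_iff)
  qed
  have const: "c u = c v" if c: "c \<in> ?A" and uv: "(u, v) \<in> ?R" for c u v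
  proof -
    have "(u, v) \<in> (adjacency G F)\<^sup>*" using uv by (simp add: connected_in_def)
    then show ?thesis
    proof (induction rule: rtrancl_induct)
      case (step y z)
      then obtain e where "e \<in> F" "ends G e = {y, z}" by (auto simp: adjacency_def)
      with c have "c y = c z" by (auto simp: constant_on_def)
      with step show ?case by simp
    qed simp
  qed
  have cls: "?R `` {u} = ?R `` {v}" if "e \<in> F" "ends G e = {u, v}" for e u v
  proof -
    have "u \<in> verts G" "v \<in> verts G" using pair[OF that(1)] that(2) by (auto simp: doubleton_eq_iff)
    then have "(u, v) \<in> ?R" using that by (auto simp: connected_in_def adjacency_def intro!: r_into_rtrancl)
    then show ?thesis using equiv equiv_class_eq by metis
  qed
  have "bij_betw (\<lambda>h. \<lambda>v\<in>verts G. h (?R `` {v})) ((verts G // ?R) \<rightarrow>\<^sub>E {..<n}) ?A"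
  proof (rule bij_betw_byWitness[where f' = "\<lambda>c. \<lambda>X\<in>verts G // ?R. c (SOME v. v \<in> X)"])
    have some: "(v, SOME w. w \<in> ?R `` {v}) \<in> ?R" if "v \<in> verts G" for v
      using someI[of "\<lambda>w. w \<in> ?R `` {v}" v] equiv_class_self[OF equiv that] by simp
    show "\<forall>h\<in>(verts G // ?R) \<rightarrow>\<^sub>E {..<n}. (\<lambda>X\<in>verts G // ?R. (\<lambda>v\<in>verts G. h (?R `` {v})) (SOME v. v \<in> X)) = h"
    proof (intro ballI ext)
      fix h X assume h: "h \<in> (verts G // ?R) \<rightarrow>\<^sub>E {..<n}"
      show "(\<lambda>X\<in>verts G // ?R. (\<lambda>v\<in>verts G. h (?R `` {v})) (SOME v. v \<in> X)) X = h X"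
      proof (cases "X \<in> verts G // ?R")
        case True
        then obtain v where v: "v \<in> verts G" "X = ?R `` {v}" by (rule quotientE)
        have "?R `` {SOME w. w \<in> X} = X"
          using equiv_class_eq[OF equiv some[OF v(1)]] unfolding v(2) by (rule sym)
        moreover have "(SOME w. w \<in> X) \<in> verts G"
          using some[OF v(1)] unfolding v(2) connected_in_def by blast
        ultimately show ?thesis using True by simp
      next
        case False
        then show ?thesis using h by (auto simp: PiE_def extensional_def)
      qed
    qed
    show "\<forall>c\<in>?A. (\<lambda>v\<in>verts G. (\<lambda>X\<in>verts G // ?R. c (SOME v. v \<in> X)) (?R `` {v})) = c"
    proof (intro ballI ext)
      fix c v assume c: "c \<in> ?A"
      show "(\<lambda>v\<in>verts G. (\<lambda>X\<in>verts G // ?R. c (SOME v. v \<in> X)) (?R `` {v})) v = c v"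
      proof (cases "v \<in> verts G")
        case True
        then show ?thesis using const[OF c some[OF True], symmetric] by (simp add: quotientI)
      next
        case False
        then show ?thesis using c by (auto simp: PiE_def extensional_def)
      qed
    qed
    show "(\<lambda>h. \<lambda>v\<in>verts G. h (?R `` {v})) ` ((verts G // ?R) \<rightarrow>\<^sub>E {..<n}) \<subseteq> ?A"
    proof (intro image_subsetI CollectI conjI ballI)
      fix h assume h: "h \<in> (verts G // ?R) \<rightarrow>\<^sub>E {..<n}"
      show "(\<lambda>v\<in>verts G. h (?R `` {v})) \<in> verts G \<rightarrow>\<^sub>E {..<n}"
        using h by (auto intro!: quotientI)
      fix e assume e: "e \<in> F"
      then obtain u v where uv: "ends G e = {u, v}" "u \<in> verts G" "v \<in> verts G"
        using pair by blast
      then show "(\<lambda>v\<in>verts G. h (?R `` {v})) constant_on ends G e"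
        using cls[OF e uv(1)] by (auto simp: constant_on_def)
    qed
    show "(\<lambda>c. \<lambda>X\<in>verts G // ?R. c (SOME v. v \<in> X)) ` ?A \<subseteq> (verts G // ?R) \<rightarrow>\<^sub>E {..<n}"
    proof (intro image_subsetI PiE_I)
      fix c X assume c: "c \<in> ?A" and X: "X \<in> verts G // ?R"
      from X obtain v where v: "v \<in> verts G" "X = ?R `` {v}" by (rule quotientE)
      have "c (SOME v. v \<in> X) = c v" using const[OF c some[OF v(1)]] v by simp
      moreover have "c v < n" using c v by (auto simp: PiE_def)
      ultimately show "(\<lambda>X\<in>verts G // ?R. c (SOME v. v \<in> X)) X \<in> {..<n}"
        using v by (simp add: quotientI)
    qed simp
  qed
  then have "card ?A = card ((verts G // ?R) \<rightarrow>\<^sub>E {..<n})" by (simp add: bij_betw_same_card)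
  also have "\<dots> = n ^ num_components G F"
    using G equiv by (subst card_funcsetE)
      (auto simp: num_components_def finite_multigraph_def finite_quotient equiv_type)
  finally show ?thesis .
qed

lemma sum_alternating_Pow:
  assumes "finite M"
  shows "(\<Sum>F\<in>Pow M. (-1) ^ card F) = (if M = {} then 1 else 0 :: 'a::comm_ring_1)"
  using prod_diff_conv_sum[OF assms, of "\<lambda>_. 1" "\<lambda>_. 1 :: 'a"] assms
  by (cases "M = {}") (simp_all add: card_gt_0_iff power_0_left)

text \<open>Inclusion-exclusion over the set of monochromatic edges. This turns the subset expansion into a
  count, so that gluing two graphs needs no bookkeeping of components.\<close>

lemma chromatic_of_nat:
  assumes G: "finite_multigraph G"
  shows "chromatic G (of_nat n :: 'a::comm_ring_1) = of_nat (card (colourings G n))"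
proof -
  let ?V = "verts G \<rightarrow>\<^sub>E {..<n}"
  let ?M = "\<lambda>c. {e \<in> edges G. c constant_on ends G e}"
  have fin: "finite ?V" "finite (edges G)"
    using G by (auto simp: finite_multigraph_def intro: finite_PiE)
  have "chromatic G (of_nat n :: 'a) =
      (\<Sum>F\<in>Pow (edges G). (-1) ^ card F * of_nat (card {c \<in> ?V. F \<subseteq> ?M c}))"
    unfolding chromatic_def
  proof (intro sum.cong refl)
    fix F assume F: "F \<in> Pow (edges G)"
    then have "{c \<in> ?V. F \<subseteq> ?M c} = {c \<in> ?V. \<forall>e\<in>F. c constant_on ends G e}" by auto
    then show "(-1) ^ card F * of_nat n ^ num_components G F =
        ((-1) ^ card F * of_nat (card {c \<in> ?V. F \<subseteq> ?M c}) :: 'a)"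
      using card_constant_on_edges[OF G, of F n] F by simp
  qed
  also have "\<dots> = (\<Sum>F\<in>Pow (edges G). \<Sum>c\<in>?V. if F \<subseteq> ?M c then (-1) ^ card F else 0)"
    using fin by (intro sum.cong refl) (simp add: sum.If_cases Int_def mult.commute)
  also have "\<dots> = (\<Sum>c\<in>?V. \<Sum>F\<in>Pow (edges G). if F \<subseteq> ?M c then (-1) ^ card F else 0)"
    by (rule sum.swap)
  also have "\<dots> = (\<Sum>c\<in>?V. \<Sum>F\<in>Pow (?M c). (-1) ^ card F)"
    using fin by (intro sum.cong refl sum.mono_neutral_cong_right) auto
  also have "\<dots> = (\<Sum>c\<in>?V. if ?M c = {} then 1 else 0)"
    using fin by (intro sum.cong refl sum_alternating_Pow) auto
  also have "\<dots> = of_nat (card {c \<in> ?V. ?M c = {}})"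
    using fin by (simp add: sum.If_cases Int_def)
  also have "{c \<in> ?V. ?M c = {}} = colourings G n"
    by (auto simp: colourings_def)
  finally show ?thesis .
qed

section \<open>Colourings of glued graphs\<close>

text \<open>A proper colouring of two glued graphs is a pair of proper colourings that agree on the glued
  vertices; the maps \<open>f\<close> and \<open>h\<close> embed the two graphs in the result.\<close>

lemma colourings_glue:
  fixes G :: "('v, 'e, 'x) multigraph_scheme" and H :: "('w, 'f, 'y) multigraph_scheme"
    and K :: "('k, 'l, 'z) multigraph_scheme"
  assumes inj: "inj_on f (verts G)" "inj_on h (verts H)"
    and verts: "verts K = f ` verts G \<union> h ` verts H"
    and edges: "edges K = f' ` edges G \<union> h' ` edges H"
    and ends: "\<And>e. e \<in> edges G \<Longrightarrow> ends K (f' e) = f ` ends G e"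
      "\<And>e. e \<in> edges H \<Longrightarrow> ends K (h' e) = h ` ends H e"
    and sub: "\<And>e. e \<in> edges G \<Longrightarrow> ends G e \<subseteq> verts G" "\<And>e. e \<in> edges H \<Longrightarrow> ends H e \<subseteq> verts H"
  shows "bij_betw (\<lambda>c. (restrict (c \<circ> f) (verts G), restrict (c \<circ> h) (verts H))) (colourings K n)
    {(c, d). c \<in> colourings G n \<and> d \<in> colourings H n \<and>
       (\<forall>v\<in>verts G. \<forall>w\<in>verts H. f v = h w \<longrightarrow> c v = d w)}"
    (is "bij_betw ?\<Phi> _ ?B")
proof (rule bij_betw_byWitness[where f' = "\<lambda>(c, d). \<lambda>x\<in>verts K.
    if x \<in> f ` verts G then c (inv_into (verts G) f x) else d (inv_into (verts H) h x)"])
  let ?\<Psi> = "\<lambda>(c, d). \<lambda>x\<in>verts K.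
    if x \<in> f ` verts G then c (inv_into (verts G) f x) else d (inv_into (verts H) h x)"
  show "\<forall>c\<in>colourings K n. ?\<Psi> (?\<Phi> c) = c"
  proof (intro ballI ext)
    fix c x assume c: "c \<in> colourings K n"
    show "?\<Psi> (?\<Phi> c) x = c x"
      using c verts by (cases "x \<in> verts K")
        (auto simp: colourings_def PiE_def extensional_def inv_into_into f_inv_into_f inj)
  qed
  have valG: "?\<Psi> (c, d) (f v) = c v" if "(c, d) \<in> ?B" "v \<in> verts G" for c d v
    using that inj verts by simp
  have valH: "?\<Psi> (c, d) (h w) = d w" if cd: "(c, d) \<in> ?B" and w: "w \<in> verts H" for c d w
  proof (cases "h w \<in> f ` verts G")
    case True
    then obtain u where u: "u \<in> verts G" "f u = h w" by auto
    have "?\<Psi> (c, d) (h w) = c u" using valG[OF cd u(1)] by (simp add: u(2))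
    also have "c u = d w" using cd u w by auto
    finally show ?thesis .
  qed (use cd w inj verts in auto)
  show "\<forall>cd\<in>?B. ?\<Phi> (?\<Psi> cd) = cd"
  proof (intro ballI)
    fix cd assume cd: "cd \<in> ?B"
    obtain c d where cd_eq: "cd = (c, d)" by force
    have B: "(c, d) \<in> ?B" using cd cd_eq by simp
    then have ext: "c \<in> extensional (verts G)" "d \<in> extensional (verts H)"
      by (auto simp: colourings_def PiE_def)
    have "restrict (?\<Psi> (c, d) \<circ> f) (verts G) = c"
      using valG[OF B] ext(1) by (intro extensionalityI[OF restrict_extensional]) simp_all
    moreover have "restrict (?\<Psi> (c, d) \<circ> h) (verts H) = d"
      using valH[OF B] ext(2) by (intro extensionalityI[OF restrict_extensional]) simp_all
    ultimately show "?\<Phi> (?\<Psi> cd) = cd" unfolding cd_eq by simp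
  qed
  have const: "c constant_on ends K (f' e) \<longleftrightarrow> restrict (c \<circ> f) (verts G) constant_on ends G e"
    if "e \<in> edges G" for c :: "'k \<Rightarrow> nat" and e
    using sub(1)[OF that] ends(1)[OF that] by (auto simp: constant_on_def subset_iff)
  have const': "c constant_on ends K (h' e) \<longleftrightarrow> restrict (c \<circ> h) (verts H) constant_on ends H e"
    if "e \<in> edges H" for c :: "'k \<Rightarrow> nat" and e
    using sub(2)[OF that] ends(2)[OF that] by (auto simp: constant_on_def subset_iff)
  show "?\<Phi> ` colourings K n \<subseteq> ?B"
  proof (intro image_subsetI)
    fix c assume c: "c \<in> colourings K n"
    have "\<not> restrict (c \<circ> f) (verts G) constant_on ends G e" if "e \<in> edges G" for e
      using const[OF that, of c] c that edges by (auto simp: colourings_def)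
    then have G: "restrict (c \<circ> f) (verts G) \<in> colourings G n"
      using c verts by (auto simp: colourings_def)
    have "\<not> restrict (c \<circ> h) (verts H) constant_on ends H e" if "e \<in> edges H" for e
      using const'[OF that, of c] c that edges by (auto simp: colourings_def)
    then have H: "restrict (c \<circ> h) (verts H) \<in> colourings H n"
      using c verts by (auto simp: colourings_def)
    with G show "?\<Phi> c \<in> ?B" by auto
  qed
  show "?\<Psi> ` ?B \<subseteq> colourings K n"
  proof (intro image_subsetI)
    fix cd assume cd: "cd \<in> ?B"
    obtain c d where cd_eq: "cd = (c, d)" by force
    have B: "(c, d) \<in> ?B" using cd cd_eq by simp
    have "restrict (?\<Psi> (c, d) \<circ> f) (verts G) = restrict c (verts G)"
      "restrict (?\<Psi> (c, d) \<circ> h) (verts H) = restrict d (verts H)"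
      using valG[OF B] valH[OF B] by (auto simp: restrict_def fun_eq_iff)
    moreover have "restrict c (verts G) = c" "restrict d (verts H) = d"
      using B by (auto simp: colourings_def PiE_def extensional_restrict)
    ultimately have r: "restrict (?\<Psi> (c, d) \<circ> f) (verts G) = c"
      "restrict (?\<Psi> (c, d) \<circ> h) (verts H) = d" by simp_all
    have cG: "c \<in> colourings G n" and dH: "d \<in> colourings H n" using B by auto
    have "?\<Psi> (c, d) x < n" if "x \<in> verts K" for x
    proof -
      from that verts consider v where "v \<in> verts G" "x = f v" | w where "w \<in> verts H" "x = h w"
        by auto
      then show ?thesis
      proof cases
        case 1
        have "c v < n" using cG 1(1) by (auto simp: colourings_def PiE_def)
        then show ?thesis using valG[OF B 1(1)] unfolding 1(2) by simp
      next
        case 2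
        have "d w < n" using dH 2(1) by (auto simp: colourings_def PiE_def)
        then show ?thesis using valH[OF B 2(1)] unfolding 2(2) by simp
      qed
    qed
    then have "?\<Psi> (c, d) \<in> verts K \<rightarrow>\<^sub>E {..<n}" by (intro PiE_I) auto
    moreover have "\<not> ?\<Psi> (c, d) constant_on ends K e" if "e \<in> edges K" for e
    proof -
      from that edges consider e1 where "e1 \<in> edges G" "e = f' e1" | e2 where "e2 \<in> edges H" "e = h' e2"
        by auto
      then show ?thesis
      proof cases
        case 1
        have "\<not> c constant_on ends G e1" using cG 1(1) by (auto simp: colourings_def)
        then show ?thesis using const[OF 1(1), of "?\<Psi> (c, d)"] r(1) 1(2) by simp
      next
        case 2
        have "\<not> d constant_on ends H e2" using dH 2(1) by (auto simp: colourings_def)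
        then show ?thesis using const'[OF 2(1), of "?\<Psi> (c, d)"] r(2) 2(2) by simp
      qed
    qed
    ultimately show "?\<Psi> cd \<in> colourings K n" unfolding cd_eq colourings_def by blast
  qed
qed

definition boundary_colourings ::
  "('v, 'e) two_terminal \<Rightarrow> nat \<Rightarrow> nat \<Rightarrow> nat \<Rightarrow> ('v \<Rightarrow> nat) set" where
  "boundary_colourings G n i j =
     {c \<in> colourings G n. c (start_vertex G) = i \<and> c (end_vertex G) = j}"

lemma finite_colourings: "finite_multigraph G \<Longrightarrow> finite (colourings G n)"
  unfolding colourings_def finite_multigraph_def
  by (rule finite_subset[of _ "verts G \<rightarrow>\<^sub>E {..<n}"]) (auto intro: finite_PiE)

(* Below, the vertex set of a composite is rewritten as a union of two images;
   the simplifier must not expand it before that. *)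
declare parallel_simps [simp del] series_simps [simp del]

text \<open>Both compositions are the disjoint union of \<open>G\<close> and \<open>H\<close> with some vertices of \<open>H\<close> renamed by
  a map \<open>r\<close> to vertices of \<open>G\<close>. The lemma is stated for an arbitrary copy \<open>K\<close> of the composite \<open>P\<close>,
  which also covers the closure of the class under isomorphism.\<close>

lemma colourings_identified_union:
  fixes G :: "('v, 'e, 'x) multigraph_scheme" and H :: "('w, 'f, 'y) multigraph_scheme"
    and P :: "('v + 'w, 'e + 'f, 'z) multigraph_scheme" and K :: "('k, 'l, 'u) multigraph_scheme"
  assumes fin: "finite_multigraph G" "finite_multigraph H"
    and r: "\<And>v. r (Inl v) = Inl v" "inj_on (\<lambda>w. r (Inr w)) (verts H)"
    and P: "verts P = r ` (verts G <+> verts H)" "edges P = edges G <+> edges H"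
      "\<And>e. ends P (Inl e) = r ` Inl ` ends G e" "\<And>e. ends P (Inr e) = r ` Inr ` ends H e"
    and p: "bij_betw p (verts P) (verts K)" "bij_betw p' (edges P) (edges K)"
      "\<And>e. e \<in> edges P \<Longrightarrow> ends K (p' e) = p ` ends P e"
  shows "bij_betw (\<lambda>c. (\<lambda>v\<in>verts G. c (p (Inl v)), \<lambda>w\<in>verts H. c (p (r (Inr w))))) (colourings K n)
    {(c, d). c \<in> colourings G n \<and> d \<in> colourings H n \<and>
       (\<forall>v\<in>verts G. \<forall>w\<in>verts H. Inl v = r (Inr w) \<longrightarrow> c v = d w)}"
proof -
  let ?f = "\<lambda>v. p (Inl v)" and ?h = "\<lambda>w. p (r (Inr w))"
  have V: "verts P = Inl ` verts G \<union> (\<lambda>w. r (Inr w)) ` verts H"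
    unfolding P(1) Plus_def image_Un image_image r(1) ..
  have injp: "inj_on p (verts P)" using p(1) by (auto simp: bij_betw_def)
  have glued: "?f v = ?h w \<longleftrightarrow> Inl v = r (Inr w)" if "v \<in> verts G" "w \<in> verts H" for v w
    using that by (intro inj_on_eq_iff[OF injp]) (auto simp: V)
  have "bij_betw (\<lambda>c. (restrict (c \<circ> ?f) (verts G), restrict (c \<circ> ?h) (verts H))) (colourings K n)
    {(c, d). c \<in> colourings G n \<and> d \<in> colourings H n \<and>
       (\<forall>v\<in>verts G. \<forall>w\<in>verts H. ?f v = ?h w \<longrightarrow> c v = d w)}"
  proof (rule colourings_glue[where f' = "\<lambda>e. p' (Inl e)" and h' = "\<lambda>e. p' (Inr e)"])
    show "inj_on ?f (verts G)"
      using inj_on_subset[OF injp, of "Inl ` verts G"] by (auto simp: V inj_on_def)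
    show "inj_on ?h (verts H)"
      using comp_inj_on[OF r(2) inj_on_subset[OF injp]] by (simp add: V comp_def)
    show "verts K = ?f ` verts G \<union> ?h ` verts H"
      using bij_betw_imp_surj_on[OF p(1)] by (simp add: V image_Un image_image)
    show "edges K = (\<lambda>e. p' (Inl e)) ` edges G \<union> (\<lambda>e. p' (Inr e)) ` edges H"
      using bij_betw_imp_surj_on[OF p(2)] by (simp add: P(2) Plus_def image_Un image_image)
    show "ends K (p' (Inl e)) = ?f ` ends G e" if "e \<in> edges G" for e
      using p(3)[of "Inl e"] that by (simp add: P(2,3) image_image r(1) InlI)
    show "ends K (p' (Inr e)) = ?h ` ends H e" if "e \<in> edges H" for e
      using p(3)[of "Inr e"] that by (simp add: P(2,4) image_image InrI)
  qed (use fin in \<open>auto simp: finite_multigraph_def\<close>)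
  then show ?thesis by (simp add: glued comp_def cong: conj_cong)
qed

text \<open>A colouring of the composite with prescribed terminal colours is a pair of colourings of the
  two parts with the same terminal colours.\<close>

lemma card_boundary_colourings_parallel:
  assumes G: "two_terminal_graph G" and H: "two_terminal_graph H"
    and K: "isomorphic (parallel G H) K"
  shows "card (boundary_colourings K n i j) =
    card (boundary_colourings G n i j) * card (boundary_colourings H n i j)"
proof -
  let ?s = "start_vertex G" and ?t = "end_vertex G"
  let ?s' = "start_vertex H" and ?t' = "end_vertex H"
  define r where "r = id(Inr ?s' := Inl ?s, Inr ?t' := Inl ?t)"
  note simps = parallel_simps[of G H, folded r_def]
  obtain p p' where p: "bij_betw p (verts (parallel G H)) (verts K)"
      "bij_betw p' (edges (parallel G H)) (edges K)"
      "\<And>e. e \<in> edges (parallel G H) \<Longrightarrow> ends K (p' e) = p ` ends (parallel G H) e"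
    and st: "p (Inl ?s) = start_vertex K" "p (Inl ?t) = end_vertex K"
    using K by (auto simp: isomorphic_def simps(5,6))
  have d: "?s \<in> verts G" "?t \<in> verts G" "?s \<noteq> ?t" "?s' \<in> verts H" "?t' \<in> verts H" "?s' \<noteq> ?t'"
    and fin: "finite_multigraph G" "finite_multigraph H"
    using G H by (auto simp: two_terminal_graph_def)
  have rInl: "r (Inl v) = Inl v" for v by (simp add: r_def)
  have rInr: "r (Inr w) = (if w = ?t' then Inl ?t else if w = ?s' then Inl ?s else Inr w)" for w
    by (simp add: r_def)
  have injH: "inj_on (\<lambda>w. r (Inr w)) (verts H)"
    using d by (auto simp: inj_on_def rInr split: if_splits)
  let ?\<Phi> = "\<lambda>c. (\<lambda>v\<in>verts G. c (p (Inl v)), \<lambda>w\<in>verts H. c (p (r (Inr w))))"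
  let ?B = "{(c, d). c \<in> colourings G n \<and> d \<in> colourings H n \<and>
       (\<forall>v\<in>verts G. \<forall>w\<in>verts H. Inl v = r (Inr w) \<longrightarrow> c v = d w)}"
  have "bij_betw ?\<Phi> (colourings K n) ?B"
    by (rule colourings_identified_union[OF fin rInl injH simps(1-4) p])
  then have "bij_betw ?\<Phi> (boundary_colourings K n i j) {y \<in> ?B. fst y ?s = i \<and> fst y ?t = j}"
    unfolding boundary_colourings_def by (rule bij_betw_Collect) (use d st in simp)
  also have "{y \<in> ?B. fst y ?s = i \<and> fst y ?t = j} =
      boundary_colourings G n i j \<times> boundary_colourings H n i j"
    using d by (auto simp: boundary_colourings_def rInr)
  finally show ?thesis by (simp add: bij_betw_same_card card_cartesian_product)
qed

lemma card_boundary_colourings_series: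
  assumes G: "two_terminal_graph G" and H: "two_terminal_graph H"
    and K: "isomorphic (series G H) K"
  shows "card (boundary_colourings K n i j) =
    (\<Sum>k<n. card (boundary_colourings G n i k) * card (boundary_colourings H n k j))"
proof -
  let ?s = "start_vertex G" and ?t = "end_vertex G"
  let ?s' = "start_vertex H" and ?t' = "end_vertex H"
  define r where "r = id(Inr ?s' := Inl ?t)"
  note simps = series_simps[of G H, folded r_def]
  obtain p p' where p: "bij_betw p (verts (series G H)) (verts K)"
      "bij_betw p' (edges (series G H)) (edges K)"
      "\<And>e. e \<in> edges (series G H) \<Longrightarrow> ends K (p' e) = p ` ends (series G H) e"
    and st: "p (Inl ?s) = start_vertex K" "p (Inr ?t') = end_vertex K"
    using K by (auto simp: isomorphic_def simps(5,6))
  have d: "?s \<in> verts G" "?t \<in> verts G" "?s \<noteq> ?t" "?s' \<in> verts H" "?t' \<in> verts H" "?s' \<noteq> ?t'"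
    and fin: "finite_multigraph G" "finite_multigraph H"
    using G H by (auto simp: two_terminal_graph_def)
  have rInl: "r (Inl v) = Inl v" for v by (simp add: r_def)
  have rInr: "r (Inr w) = (if w = ?s' then Inl ?t else Inr w)" for w
    by (simp add: r_def)
  have injH: "inj_on (\<lambda>w. r (Inr w)) (verts H)"
    using d by (auto simp: inj_on_def rInr split: if_splits)
  let ?\<Phi> = "\<lambda>c. (\<lambda>v\<in>verts G. c (p (Inl v)), \<lambda>w\<in>verts H. c (p (r (Inr w))))"
  let ?B = "{(c, d). c \<in> colourings G n \<and> d \<in> colourings H n \<and>
       (\<forall>v\<in>verts G. \<forall>w\<in>verts H. Inl v = r (Inr w) \<longrightarrow> c v = d w)}"
  have "bij_betw ?\<Phi> (colourings K n) ?B"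
    by (rule colourings_identified_union[OF fin rInl injH simps(1-4) p])
  then have "bij_betw ?\<Phi> (boundary_colourings K n i j) {y \<in> ?B. fst y ?s = i \<and> snd y ?t' = j}"
    unfolding boundary_colourings_def by (rule bij_betw_Collect) (use d st in \<open>simp add: rInr\<close>)
  \<comment> \<open>The union is over the colour of the glued vertex.\<close>
  also have "{y \<in> ?B. fst y ?s = i \<and> snd y ?t' = j} =
      (\<Union>k<n. boundary_colourings G n i k \<times> boundary_colourings H n k j)"
    using d by (auto simp: boundary_colourings_def colourings_def rInr)
  finally have "card (boundary_colourings K n i j) =
      card (\<Union>k<n. boundary_colourings G n i k \<times> boundary_colourings H n k j)"
    by (rule bij_betw_same_card)
  also have "\<dots> = (\<Sum>k<n. card (boundary_colourings G n i k \<times> boundary_colourings H n k j))"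
    using finite_colourings[OF fin(1)] finite_colourings[OF fin(2)]
    by (intro card_UN_disjoint) (auto simp: boundary_colourings_def)
  finally show ?thesis by (simp add: card_cartesian_product)
qed

section \<open>Colouring weights of the compositions\<close>

text \<open>The two polynomials are the parts \<open>a\<close> (different terminal colours) and \<open>b\<close> (equal terminal
  colours) of the count. They are polynomials over the complex numbers so that they can be evaluated
  at the roots.\<close>

definition has_weights :: "('v, 'e) two_terminal \<Rightarrow> complex poly \<Rightarrow> complex poly \<Rightarrow> bool" where
  "has_weights G a b \<longleftrightarrow>
     (\<forall>n. \<forall>i<n. \<forall>j<n. of_nat (card (boundary_colourings G n i j)) =
        poly (if i = j then b else a) (of_nat n))"

lemma has_weights_K2:
  assumes "is_K2 G"
  shows "has_weights G 1 0"
proof -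
  obtain s t e where st: "start_vertex G = s" "end_vertex G = t" "s \<noteq> t" "verts G = {s, t}"
      "edges G = {e}" "ends G e = {s, t}"
    using assms by (auto simp: is_K2_def)
  have "boundary_colourings G n i j = (if i = j then {} else {(\<lambda>_. undefined)(s := i, t := j)})"
    if "i < n" "j < n" for n i j
    using st that
    by (auto simp: boundary_colourings_def colourings_def constant_on_def PiE_def extensional_def)
  then show ?thesis by (simp add: has_weights_def)
qed

lemma has_weights_parallel:
  assumes "two_terminal_graph G" "two_terminal_graph H" "isomorphic (parallel G H) K"
    and "has_weights G a b" "has_weights H a' b'"
  shows "has_weights K (a * a') (b * b')"
  using assms(4,5) unfolding has_weights_def
  by (simp add: card_boundary_colourings_parallel[OF assms(1-3)])

lemma sum_lessThan_two_cases:
  fixes x y :: "'a::comm_ring_1"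
  assumes "i < n" "j < n" "i \<noteq> j"
  shows "(\<Sum>k<n. if k = i then x else if k = j then y else z) = x + y + (of_nat n - 2) * z"
proof -
  have "(\<Sum>k<n. if k = i then x else if k = j then y else z) =
      (\<Sum>k<n. (if k = i then x - z else 0) + (if k = j then y - z else 0) + z)"
    using assms(3) by (intro sum.cong) auto
  also have "\<dots> = x + y + (of_nat n - 2) * z"
    using assms by (simp add: sum.distrib algebra_simps)
  finally show ?thesis .
qed

text \<open>Summation over the colour \<open>k\<close> of the glued vertex: \<open>k\<close> may equal one of the terminal colours, which
  leaves \<open>n - 1\<close> or \<open>n - 2\<close> other colours if the terminal colours are equal or different.\<close>

lemma has_weights_series:
  assumes "two_terminal_graph G" "two_terminal_graph H" "isomorphic (series G H) K"
    and G: "has_weights G a b" and H: "has_weights H a' b'"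
  shows "has_weights K (a * b' + b * a' + [:-2, 1:] * a * a') (b * b' + [:-1, 1:] * a * a')"
  unfolding has_weights_def
proof (intro allI impI)
  fix n i j :: nat
  assume ij: "i < n" "j < n"
  let ?n = "of_nat n :: complex"
  let ?A = "poly a ?n" and ?B = "poly b ?n" and ?A' = "poly a' ?n" and ?B' = "poly b' ?n"
  have "of_nat (card (boundary_colourings K n i j)) =
      (\<Sum>k<n. (if i = k then ?B else ?A) * (if k = j then ?B' else ?A'))"
    using G H ij
    by (simp add: card_boundary_colourings_series[OF assms(1-3)] has_weights_def
        if_distrib[of "\<lambda>p. poly p ?n"])
  also have "\<dots> = poly (if i = j then b * b' + [:-1, 1:] * a * a' else a * b' + b * a' + [:-2, 1:] * a * a') ?n"
  proof (cases "i = j")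
    case True
    have "(\<Sum>k<n. (if i = k then ?B else ?A) * (if k = j then ?B' else ?A')) =
        (\<Sum>k<n. (if k = i then ?B * ?B' - ?A * ?A' else 0) + ?A * ?A')"
      using True by (intro sum.cong) auto
    also have "\<dots> = ?B * ?B' + (?n - 1) * (?A * ?A')"
      using ij by (simp add: sum.distrib algebra_simps)
    finally show ?thesis using True by (simp add: algebra_simps)
  next
    case False
    have "(\<Sum>k<n. (if i = k then ?B else ?A) * (if k = j then ?B' else ?A')) =
        (\<Sum>k<n. if k = i then ?B * ?A' else if k = j then ?A * ?B' else ?A * ?A')"
      using False by (intro sum.cong) auto
    then show ?thesis
      using False by (simp add: sum_lessThan_two_cases[OF ij False] algebra_simps)
  qed
  finally show "of_nat (card (boundary_colourings K n i j)) =
    poly (if i = j then b * b' + [:-1, 1:] * a * a' else a * b' + b * a' + [:-2, 1:] * a * a') ?n" .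
qed

text \<open>Both sides are polynomials in \<open>z\<close>, and at every natural number \<open>n\<close> both count the proper
  \<open>n\<close>-colourings: there are \<open>n\<close> ways to choose equal terminal colours and \<open>n (n - 1)\<close> ways to choose
  different ones.\<close>

lemma chromatic_eq_weights:
  assumes G: "two_terminal_graph G" and w: "has_weights G a b"
  shows "chromatic G z = z * (poly b z + (z - 1) * poly a z)"
proof -
  define P where "P = (\<Sum>F\<in>Pow (edges G). monom ((-1) ^ card F :: complex) (num_components G F))"
  define Q where "Q = [:0, 1:] * (b + [:-1, 1:] * a)"
  have P: "poly P x = chromatic G x" for x
    by (simp add: P_def chromatic_def poly_sum poly_monom)
  have Q: "poly Q x = x * (poly b x + (x - 1) * poly a x)" for x
    by (simp add: Q_def algebra_simps)
  have fin: "finite_multigraph G" and st: "start_vertex G \<in> verts G" "end_vertex G \<in> verts G"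
    using G by (auto simp: two_terminal_graph_def)
  have "poly P (of_nat n) = poly Q (of_nat n)" for n
  proof -
    let ?C = "\<lambda>p. boundary_colourings G n (fst p) (snd p)"
    have "colourings G n = (\<Union>p\<in>{..<n} \<times> {..<n}. ?C p)"
      using st by (auto simp: boundary_colourings_def colourings_def)
    moreover have "card (\<Union>p\<in>{..<n} \<times> {..<n}. ?C p) = (\<Sum>p\<in>{..<n} \<times> {..<n}. card (?C p))"
      using finite_colourings[OF fin]
      by (intro card_UN_disjoint) (auto simp: boundary_colourings_def)
    ultimately have "card (colourings G n) = (\<Sum>p\<in>{..<n} \<times> {..<n}. card (?C p))" by simp
    then have "of_nat (card (colourings G n)) =
        (\<Sum>i<n. \<Sum>j<n. of_nat (card (boundary_colourings G n i j)) :: complex)"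
      by (simp add: sum.cartesian_product split_beta)
    also have "\<dots> = (\<Sum>i<n. \<Sum>j<n. if i = j then poly b (of_nat n) else poly a (of_nat n))"
      using w by (intro sum.cong refl) (simp add: has_weights_def)
    also have "\<dots> = (\<Sum>i<n. \<Sum>j<n. (if i = j then poly b (of_nat n) - poly a (of_nat n) else 0)
        + poly a (of_nat n))"
      by (intro sum.cong refl) simp
    also have "\<dots> = poly Q (of_nat n)"
      by (simp add: Q sum.distrib algebra_simps)
    finally show ?thesis by (simp add: P chromatic_of_nat[OF fin])
  qed
  then have "range (of_nat :: nat \<Rightarrow> complex) \<subseteq> {x. poly (P - Q) x = 0}" by auto
  moreover have "infinite (range (of_nat :: nat \<Rightarrow> complex))"
    by (simp add: finite_image_iff inj_of_nat)
  ultimately have "P - Q = 0" using poly_roots_finite finite_subset by blast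
  then show ?thesis using P[of z] Q[of z] by simp
qed

text \<open>The compositions change the vertex and edge types; this brings them back to the natural numbers.\<close>

lemma isomorphic_nat_copy:
  fixes G :: "('v::countable, 'e::countable) two_terminal"
  shows "\<exists>K :: (nat, nat) two_terminal. isomorphic G K"
proof
  let ?K = "\<lparr>verts = to_nat ` verts G, edges = to_nat ` edges G,
    ends = (\<lambda>e. to_nat ` ends G (from_nat e)),
    start_vertex = to_nat (start_vertex G), end_vertex = to_nat (end_vertex G)\<rparr>"
  show "isomorphic G ?K"
    unfolding isomorphic_def
    by (intro exI[of _ to_nat]) (auto simp: bij_betw_def inj_on_def)
qed

section \<open>Weights realized by series-parallel graphs\<close>

definition realizable :: "complex poly \<Rightarrow> complex poly \<Rightarrow> bool" where
  "realizable a b \<longleftrightarrow> (\<exists>G. series_parallel G \<and> has_weights G a b)"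

lemma realizable_K2: "realizable 1 0"
proof -
  let ?G = "\<lparr>verts = {0, 1}, edges = {0}, ends = (\<lambda>_. {0, 1}), start_vertex = 0, end_vertex = 1\<rparr>
    :: (nat, nat) two_terminal"
  have "is_K2 ?G" by (simp add: is_K2_def)
  then show ?thesis unfolding realizable_def using series_parallel.K2 has_weights_K2 by blast
qed

lemma realizable_parallel:
  assumes "realizable a b" "realizable a' b'"
  shows "realizable (a * a') (b * b')"
proof -
  obtain G H where GH: "series_parallel G" "has_weights G a b" "series_parallel H" "has_weights H a' b'"
    using assms by (auto simp: realizable_def)
  obtain K :: "(nat, nat) two_terminal" where "isomorphic (parallel G H) K"
    using isomorphic_nat_copy by blast
  with GH show ?thesis unfolding realizable_def
    by (meson has_weights_parallel series_parallel.parallel series_parallel_two_terminal_graph)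
qed

lemma realizable_series:
  assumes "realizable a b" "realizable a' b'"
  shows "realizable (a * b' + b * a' + [:-2, 1:] * a * a') (b * b' + [:-1, 1:] * a * a')"
proof -
  obtain G H where GH: "series_parallel G" "has_weights G a b" "series_parallel H" "has_weights H a' b'"
    using assms by (auto simp: realizable_def)
  obtain K :: "(nat, nat) two_terminal" where "isomorphic (series G H) K"
    using isomorphic_nat_copy by blast
  with GH show ?thesis unfolding realizable_def
    by (meson has_weights_series series_parallel.series series_parallel_two_terminal_graph)
qed

text \<open>If \<open>a(z) \<noteq> 0\<close>, the condition says that the interaction \<open>b(z) / a(z)\<close> equals \<open>1 - z\<close>.\<close>

lemma realizable_imp_chromatic_root:
  assumes "realizable a b" and "poly b z = (1 - z) * poly a z"
  shows "\<exists>G. series_parallel G \<and> chromatic G z = 0"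
proof -
  obtain G where G: "series_parallel G" "has_weights G a b"
    using assms(1) by (auto simp: realizable_def)
  then have "chromatic G z = 0"
    using chromatic_eq_weights[OF series_parallel_two_terminal_graph[OF G(1)] G(2), of z] assms(2)
    by (simp add: algebra_simps)
  with G show ?thesis by blast
qed

lemma realizable_power:
  assumes "realizable a b" "n > 0"
  shows "realizable (a ^ n) (b ^ n)"
  using assms(2)
proof (induction n rule: nat_induct_non_zero)
  case (Suc n)
  then show ?case using realizable_parallel[OF assms(1)] by simp
qed (use assms in simp)

text \<open>The exponent \<open>m = 0\<close> stands for leaving out the second graph. At least one graph must
  remain because the trivial weights \<open>(1, 1)\<close> belong to an edgeless graph, which is not series-parallel.\<close>

lemma realizable_power_mult:
  assumes "realizable a b" "realizable a' b'" "n > 0"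
  shows "realizable (a ^ n * a' ^ m) (b ^ n * b' ^ m)"
  using realizable_parallel[OF realizable_power[OF assms(1,3)] realizable_power[OF assms(2)], of m]
    realizable_power[OF assms(1,3)] by (cases "m = 0") auto

lemma realizable_path2: "realizable [:-2, 1:] [:-1, 1:]"
  using realizable_series[OF realizable_K2 realizable_K2] by simp

lemma realizable_path3: "realizable [:3, -3, 1:] ([:-1, 1:] * [:-2, 1:])"
  using realizable_series[OF realizable_path2 realizable_K2] by simp

section \<open>Integer combinations of logarithms\<close>

text \<open>Dividing \<open>n U + m V - w\<close> by \<open>n\<close> and letting \<open>m / n\<close> tend to \<open>\<alpha> / \<beta>\<close> gives a limit with the zero
  \<open>z0\<close>; by Hurwitz's theorem the approximating functions cannot all be free of zeros.\<close>

lemma integer_combination_solution: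
  fixes U V w :: "complex \<Rightarrow> complex" and \<alpha> \<beta> :: real
  assumes S: "open S" "connected S" "z0 \<in> S"
    and hol: "U holomorphic_on S" "V holomorphic_on S" "w holomorphic_on S"
    and U: "U z0 = - of_real \<alpha>" "\<alpha> > 0" and V: "V z0 = of_real \<beta>" "\<beta> > 0"
    and nonconst: "\<not> (\<lambda>z. U z + of_real (\<alpha> / \<beta>) * V z) constant_on S"
  shows "\<exists>n m z. n > 0 \<and> z \<in> S \<and> of_nat n * U z + of_nat m * V z = w z"
proof (rule ccontr)
  assume none: "\<not> ?thesis"
  define m where "m n = nat \<lfloor>of_nat (Suc n) * (\<alpha> / \<beta>)\<rfloor>" for n
  define F where "F n z = U z + of_real (of_nat (m n) / of_nat (Suc n)) * V z
    - of_real (1 / of_nat (Suc n)) * w z" for n z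
  \<comment> \<open>The vanishing coefficient of \<open>w\<close> is kept to match the shape of \<open>F\<close> in the limit argument.\<close>
  define g where "g z = U z + of_real (\<alpha> / \<beta>) * V z - of_real 0 * w z" for z
  have "\<bar>real (m n) / real (Suc n) - \<alpha> / \<beta>\<bar> \<le> 1 / real (Suc n)" for n
  proof -
    have "0 \<le> of_nat (Suc n) * (\<alpha> / \<beta>)" using U V by simp
    then have "\<bar>real (m n) - of_nat (Suc n) * (\<alpha> / \<beta>)\<bar> \<le> 1"
      unfolding m_def by linarith
    then have "\<bar>real (m n) - of_nat (Suc n) * (\<alpha> / \<beta>)\<bar> / real (Suc n) \<le> 1 / real (Suc n)"
      by (intro divide_right_mono) simp_all
    also have "\<bar>real (m n) - of_nat (Suc n) * (\<alpha> / \<beta>)\<bar> / real (Suc n) =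
        \<bar>(real (m n) - of_nat (Suc n) * (\<alpha> / \<beta>)) / real (Suc n)\<bar>"
      by (simp add: abs_divide)
    also have "(real (m n) - of_nat (Suc n) * (\<alpha> / \<beta>)) / real (Suc n) =
        real (m n) / real (Suc n) - \<alpha> / \<beta>"
      by (simp add: diff_divide_distrib del: of_nat_Suc)
    finally show ?thesis .
  qed
  then have "(\<lambda>n. real (m n) / real (Suc n) - \<alpha> / \<beta>) \<longlonglongrightarrow> 0"
    by (intro Lim_null_comparison[OF _ LIMSEQ_inverse_real_of_nat]) (simp add: inverse_eq_divide)
  then have lim: "(\<lambda>n. of_real (real (m n) / real (Suc n))) \<longlonglongrightarrow> (of_real (\<alpha> / \<beta>) :: complex)"
    by (intro tendsto_of_real) (simp add: LIM_zero_iff)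
  have lim0: "(\<lambda>n. of_real (1 / of_nat (Suc n))) \<longlonglongrightarrow> (of_real 0 :: complex)"
    using LIMSEQ_inverse_real_of_nat by (intro tendsto_of_real) (simp add: inverse_eq_divide)
  \<comment> \<open>Holomorphic functions are bounded on compact sets, so convergence of the scalar coefficients is uniform.\<close>
  have unif: "uniform_limit K (\<lambda>n z. c n * f z) (\<lambda>z. l * f z) sequentially"
    if "c \<longlonglongrightarrow> l" "f holomorphic_on S" "compact K" "K \<subseteq> S" for c l f K
  proof (rule uniform_lim_mult)
    show "uniform_limit K (\<lambda>n z. c n) (\<lambda>z. l) sequentially"
      using that(1) by (auto simp: uniform_limit_iff tendsto_iff elim!: eventually_mono)
    have "continuous_on K f"
      using that by (meson continuous_on_subset holomorphic_on_imp_continuous_on)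
    then show "bounded (f ` K)"
      using that(3) compact_continuous_image compact_imp_bounded by blast
  qed (auto simp: image_constant_conv uniform_limit_iff)
  have "g z0 \<noteq> 0"
  proof (rule Hurwitz_no_zeros[where \<F> = F and S = S and g = g and ?z0.0 = z0])
    show "F n holomorphic_on S" for n
      unfolding F_def using hol by (intro holomorphic_intros)
    show "g holomorphic_on S"
      unfolding g_def using hol by (intro holomorphic_intros)
    show "uniform_limit K F g sequentially" if "compact K" "K \<subseteq> S" for K
      unfolding F_def[abs_def] g_def[abs_def]
      by (intro uniform_limit_intros unif lim lim0 hol that)
    show "\<not> g constant_on S" using nonconst unfolding g_def[abs_def] by simp
    show "F n z \<noteq> 0" if "z \<in> S" for n z
    proof
      assume "F n z = 0"
      then have "of_nat (Suc n) * F n z = 0" by simp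
      then have "of_nat (Suc n) * U z + of_nat (m n) * V z = w z"
        by (simp add: F_def algebra_simps del: of_nat_Suc)
      with none that show False by blast
    qed
  qed (use S in auto)
  then show False using U V by (simp add: g_def)
qed

text \<open>The square makes the argument of the logarithm positive at points where the interaction is real
  and nonzero, so that the principal branch is holomorphic nearby.\<close>

definition log_interaction :: "complex poly \<Rightarrow> complex poly \<Rightarrow> complex \<Rightarrow> complex" where
  "log_interaction a b z = Ln ((poly b z / poly a z)\<^sup>2)"

text \<open>Exponentiating a solution of \<open>n U + m V = w\<close>, where \<open>U\<close> and \<open>V\<close> are the logarithms of the squared
  interactions, gives interaction \<open>1 - z\<close> for the parallel composition of \<open>2n\<close> copies of one graph
  with \<open>2m\<close> copies of the other.\<close>

lemma chromatic_root_from_two_graphs: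
  assumes real: "realizable a b" "realizable a' b'"
    and S: "open S" "connected S" "of_real x \<in> S"
    and dom: "\<And>z. z \<in> S \<Longrightarrow> Re ((poly b z / poly a z)\<^sup>2) > 0"
      "\<And>z. z \<in> S \<Longrightarrow> Re ((poly b' z / poly a' z)\<^sup>2) > 0"
      "\<And>z. z \<in> S \<Longrightarrow> Re z > 1"
    and y: "poly b (of_real x) / poly a (of_real x) = of_real y" "\<bar>y\<bar> < 1"
    and y': "poly b' (of_real x) / poly a' (of_real x) = of_real y'" "\<bar>y'\<bar> > 1"
    and nonconst: "\<not> (\<lambda>z. log_interaction a b z
        + of_real (- ln (y\<^sup>2) / ln (y'\<^sup>2)) * log_interaction a' b' z) constant_on S"
  shows "\<exists>z\<in>S. \<exists>G. series_parallel G \<and> chromatic G z = 0"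
proof -
  \<comment> \<open>A logarithm of \<open>1 - z\<close>: near \<open>x > 1\<close> this number is close to the branch cut, but \<open>z - 1\<close> is not.\<close>
  let ?w = "\<lambda>z. Ln (z - 1) + \<i> * of_real pi"
  have hol: "log_interaction a b holomorphic_on S" if "\<And>z. z \<in> S \<Longrightarrow> Re ((poly b z / poly a z)\<^sup>2) > 0" for a b
    unfolding log_interaction_def[abs_def]
    using that by (intro holomorphic_intros) (force simp: complex_nonpos_Reals_iff)+
  have y0: "y \<noteq> 0" using dom(1)[OF S(3)] y(1) by auto
  have y'0: "y' \<noteq> 0" using y'(2) by auto
  have "y\<^sup>2 < 1" using y(2) by (simp add: abs_square_less_1)
  then have \<alpha>: "- ln (y\<^sup>2) > 0" using y0 by (simp add: ln_less_zero)
  have "y'\<^sup>2 > 1" using y'(2) by (meson abs_square_le_1 not_less)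
  then have \<beta>: "ln (y'\<^sup>2) > 0" by (rule ln_gt_zero)
  have "\<exists>n m z. n > 0 \<and> z \<in> S \<and>
      of_nat n * log_interaction a b z + of_nat m * log_interaction a' b' z = ?w z"
  proof (rule integer_combination_solution[OF S hol hol])
    show "?w holomorphic_on S"
      using dom(3) by (intro holomorphic_intros) (force simp: complex_nonpos_Reals_iff)
    show "log_interaction a b (of_real x) = - of_real (- ln (y\<^sup>2))"
      using y0 by (simp add: log_interaction_def y(1) Ln_of_real flip: of_real_power)
    show "log_interaction a' b' (of_real x) = of_real (ln (y'\<^sup>2))"
      using y'0 by (simp add: log_interaction_def y'(1) Ln_of_real flip: of_real_power)
  qed (fact dom \<alpha> \<beta> nonconst)+
  then obtain n m z where n: "n > 0" and z: "z \<in> S"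
    and eq: "of_nat n * log_interaction a b z + of_nat m * log_interaction a' b' z = ?w z" by blast
  have nz: "poly a z \<noteq> 0" "poly a' z \<noteq> 0" "poly b z \<noteq> 0" "poly b' z \<noteq> 0" "z \<noteq> 1"
    using dom[OF z] by auto
  have "exp (of_nat n * log_interaction a b z + of_nat m * log_interaction a' b' z) =
      ((poly b z / poly a z)\<^sup>2) ^ n * ((poly b' z / poly a' z)\<^sup>2) ^ m"
    using nz by (simp add: exp_add exp_of_nat_mult log_interaction_def)
  moreover have "exp (?w z) = 1 - z"
    using nz by (simp add: exp_add)
  ultimately have "((poly b z / poly a z)\<^sup>2) ^ n * ((poly b' z / poly a' z)\<^sup>2) ^ m = 1 - z"
    using eq by simp
  then have "poly (b ^ (2 * n) * b' ^ (2 * m)) z = (1 - z) * poly (a ^ (2 * n) * a' ^ (2 * m)) z"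
    using nz by (simp add: power_divide field_simps flip: power_mult)
  moreover have "realizable (a ^ (2 * n) * a' ^ (2 * m)) (b ^ (2 * n) * b' ^ (2 * m))"
    using n by (intro realizable_power_mult[OF real]) simp
  ultimately show ?thesis using realizable_imp_chromatic_root z by blast
qed

section \<open>Roots near a point with an expanding graph\<close>

lemma has_field_derivative_Ln_square:
  assumes "(f has_field_derivative f') (at z)" and "(f z)\<^sup>2 \<notin> \<real>\<^sub>\<le>\<^sub>0"
  shows "((\<lambda>z. Ln ((f z)\<^sup>2)) has_field_derivative 2 * f' / f z) (at z)"
proof -
  have "f z \<noteq> 0" using assms(2) by auto
  then show ?thesis using assms
    by (auto intro!: derivative_eq_intros simp: field_simps power2_eq_square)
qed

text \<open>The two functions are the interactions of the paths with three and two edges. A linear relation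
  between their logarithms differentiates, after clearing denominators, to
  \<open>(2z - 3) = k (z\<^sup>2 - 3z + 3)\<close>, which no \<open>k\<close> satisfies on an infinite set.\<close>

lemma path_log_derivatives_independent:
  assumes S: "open S" "z0 \<in> S"
    and dom: "\<And>z. z \<in> S \<Longrightarrow> Re (((z - 1) / (z - 2))\<^sup>2) > 0"
      "\<And>z. z \<in> S \<Longrightarrow> Re (((z - 1) * (z - 2) / (z\<^sup>2 - 3 * z + 3))\<^sup>2) > 0"
  shows "\<not> (\<lambda>z. Ln (((z - 1) * (z - 2) / (z\<^sup>2 - 3 * z + 3))\<^sup>2) + k * Ln (((z - 1) / (z - 2))\<^sup>2)) constant_on S"
    (is "\<not> ?g constant_on S")
proof
  assume "?g constant_on S"
  then obtain c where c: "\<And>z. z \<in> S \<Longrightarrow> ?g z = c" by (auto simp: constant_on_def)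
  have "poly [:3 * k + 3, - 3 * k - 2, k:] z = 0" if z: "z \<in> S" for z
  proof -
    have nz: "z - 1 \<noteq> 0" "z - 2 \<noteq> 0" "z\<^sup>2 - 3 * z + 3 \<noteq> 0" using dom[OF z] by auto
    have ln: "((z - 1) / (z - 2))\<^sup>2 \<notin> \<real>\<^sub>\<le>\<^sub>0"
      "((z - 1) * (z - 2) / (z\<^sup>2 - 3 * z + 3))\<^sup>2 \<notin> \<real>\<^sub>\<le>\<^sub>0"
      using dom[OF z] by (auto simp: complex_nonpos_Reals_iff)
    have "(?g has_field_derivative
        2 * (2 * z - 3) / ((z - 1) * (z - 2) * (z\<^sup>2 - 3 * z + 3)) + k * (- 2 / ((z - 1) * (z - 2)))) (at z)"
    proof -
      have "((\<lambda>z. (z - 1) / (z - 2)) has_field_derivative - 1 / (z - 2)\<^sup>2) (at z)"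
        using nz by (auto intro!: derivative_eq_intros simp: power2_eq_square)
      note 1 = has_field_derivative_Ln_square[OF this ln(1)]
      have "((\<lambda>z. (z - 1) * (z - 2) / (z\<^sup>2 - 3 * z + 3)) has_field_derivative
          (2 * z - 3) / (z\<^sup>2 - 3 * z + 3)\<^sup>2) (at z)"
        using nz by (auto intro!: derivative_eq_intros) (simp add: field_simps power2_eq_square)
      note 2 = has_field_derivative_Ln_square[OF this ln(2)]
      have "2 * (N / D\<^sup>2) / (u * v / D) = 2 * N / (u * v * D)"
        "2 * (- 1 / v\<^sup>2) / (u / v) = - 2 / (u * v)"
        if "u \<noteq> 0" "v \<noteq> 0" "D \<noteq> 0" for N D u v :: complex
        using that by (simp_all add: divide_simps power2_eq_square)
      note eqs = this[OF nz]
      show ?thesis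
        by (rule DERIV_cong[OF DERIV_add[OF 2 DERIV_cmult[OF 1]]]) (simp only: eqs)
    qed
    moreover have "(?g has_field_derivative 0) (at z)"
      by (rule has_field_derivative_transform_within_open[OF DERIV_const S(1) z]) (simp add: c)
    ultimately have "2 * (2 * z - 3) / ((z - 1) * (z - 2) * (z\<^sup>2 - 3 * z + 3)) + k * (- 2 / ((z - 1) * (z - 2))) = 0"
      by (rule DERIV_unique)
    moreover have as_fraction: "2 * N / (u * v * D) + k * (- 2 / (u * v)) = (2 * N - 2 * k * D) / (u * v * D)"
      if "u \<noteq> 0" "v \<noteq> 0" "D \<noteq> 0" for N D u v :: complex
      using that by (simp add: field_simps)
    ultimately have "2 * (2 * z - 3) - 2 * k * (z\<^sup>2 - 3 * z + 3) = 0"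
      using as_fraction[OF nz, of "2 * z - 3"] nz by (simp only: divide_eq_0_iff mult_eq_0_iff) simp
    moreover have "2 * poly [:3 * k + 3, - 3 * k - 2, k:] z = - (2 * (2 * z - 3) - 2 * k * (z\<^sup>2 - 3 * z + 3))"
      by (simp add: algebra_simps power2_eq_square)
    ultimately have "2 * poly [:3 * k + 3, - 3 * k - 2, k:] z = 0" by (simp only: minus_zero)
    then show ?thesis by (simp only: mult_eq_0_iff) simp
  qed
  then have "S \<subseteq> {z. poly [:3 * k + 3, - 3 * k - 2, k:] z = 0}" by blast
  moreover have "infinite S" using S by (metis finite_imp_not_open empty_iff)
  ultimately have "[:3 * k + 3, - 3 * k - 2, k:] = 0"
    using poly_roots_finite finite_subset by blast
  then show False by auto
qed

lemma eventually_interaction_in_half_plane: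
  assumes "poly b (of_real x) / poly a (of_real x) = (of_real y :: complex)" "y \<noteq> 0"
  shows "\<forall>\<^sub>F z in nhds (of_real x). Re ((poly b z / poly a z)\<^sup>2) > 0"
proof -
  let ?f = "\<lambda>z. Re ((poly b z / poly a z)\<^sup>2)"
  have "poly a (of_real x) \<noteq> 0" using assms by auto
  then have "isCont ?f (of_real x)"
    by (intro continuous_Re isCont_power isCont_divide poly_isCont)
  then have "(?f \<longlongrightarrow> ?f (of_real x)) (nhds (of_real x))"
    unfolding isCont_def by (simp only: tendsto_at_iff_tendsto_nhds[where g = ?f])
  moreover have "?f (of_real x) > 0"
    using assms by (simp flip: of_real_power)
  ultimately show ?thesis by (rule order_tendstoD(1))
qed

text \<open>The path with three edges always contracts. The path with two edges expands for \<open>x > 3/2\<close>, and then the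
  two paths form a suitable pair. Otherwise it contracts as well, and each path can be paired
  with the given expanding graph; the limit function cannot be constant for both paths, since eliminating the
  expanding graph would give a linear relation between the logarithms of the paths. The excluded
  points \<open>2\<close> and \<open>3/2\<close> are where the interaction of the path with two edges has a pole or is \<open>-1\<close>.\<close>

lemma chromatic_roots_near_expanding_point:
  fixes x :: real
  assumes ab: "realizable a b" "poly b (of_real x) / poly a (of_real x) = of_real y" "\<bar>y\<bar> > 1"
    and x: "x > 1" "x \<noteq> 2" "x \<noteq> 3 / 2" and "\<epsilon> > 0"
  shows "\<exists>z. cmod (z - of_real x) < \<epsilon> \<and> (\<exists>G. series_parallel G \<and> chromatic G z = 0)"
proof -
  let ?a2 = "[:-2, 1:] :: complex poly" and ?b2 = "[:-1, 1:] :: complex poly"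
  let ?a3 = "[:3, -3, 1:] :: complex poly" and ?b3 = "[:-1, 1:] * [:-2, 1:] :: complex poly"
  define y2 where "y2 = (x - 1) / (x - 2)"
  define y3 where "y3 = (x - 1) * (x - 2) / (x\<^sup>2 - 3 * x + 3)"
  have val2: "poly ?b2 (of_real x) / poly ?a2 (of_real x) = of_real y2"
    by (simp add: y2_def)
  have val3: "poly ?b3 (of_real x) / poly ?a3 (of_real x) = of_real y3"
    by (simp add: y3_def algebra_simps power2_eq_square)
  have pos: "x\<^sup>2 - 3 * x + 3 > 0"
  proof -
    have "x\<^sup>2 - 3 * x + 3 = (x - 3 / 2)\<^sup>2 + 3 / 4" by (simp add: algebra_simps power2_eq_square)
    then show ?thesis by (smt (verit) zero_le_power2 divide_pos_pos)
  qed
  have nz: "y \<noteq> 0" "y2 \<noteq> 0" "y3 \<noteq> 0" using ab(3) x pos by (auto simp: y2_def y3_def)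
  have y3: "\<bar>y3\<bar> < 1"
  proof -
    have "\<bar>(x - 1) * (x - 2)\<bar> < x\<^sup>2 - 3 * x + 3"
    proof -
      have "2 * x\<^sup>2 - 6 * x + 5 = 2 * (x - 3 / 2)\<^sup>2 + 1 / 2" by (simp add: algebra_simps power2_eq_square)
      then have "2 * x\<^sup>2 - 6 * x + 5 > 0" by (smt (verit) zero_le_power2 divide_pos_pos)
      then show ?thesis by (simp add: abs_less_iff algebra_simps power2_eq_square)
    qed
    then show ?thesis using pos by (simp add: y3_def abs_divide)
  qed
  have "\<forall>\<^sub>F z in nhds (of_real x). Re ((poly b z / poly a z)\<^sup>2) > 0 \<and>
      Re ((poly ?b2 z / poly ?a2 z)\<^sup>2) > 0 \<and> Re ((poly ?b3 z / poly ?a3 z)\<^sup>2) > 0 \<and> Re z > 1"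
  proof (intro eventually_conj)
    show "\<forall>\<^sub>F z in nhds (of_real x). Re z > 1"
      using order_tendstoD(1)[OF tendsto_Re[OF filterlim_ident[of "nhds (of_real x)"]], of 1] x by simp
  qed (rule eventually_interaction_in_half_plane[OF ab(2) nz(1)]
      eventually_interaction_in_half_plane[OF val2 nz(2)]
      eventually_interaction_in_half_plane[OF val3 nz(3)])+
  then obtain r where r: "r > 0" and dom: "\<And>z. dist z (of_real x) < r \<Longrightarrow>
      Re ((poly b z / poly a z)\<^sup>2) > 0 \<and>
      Re ((poly ?b2 z / poly ?a2 z)\<^sup>2) > 0 \<and> Re ((poly ?b3 z / poly ?a3 z)\<^sup>2) > 0 \<and> Re z > 1"
    unfolding eventually_nhds_metric by blast
  define S where "S = ball (of_real x :: complex) (min r \<epsilon>)"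
  have S: "open S" "connected S" "of_real x \<in> S" using r \<open>\<epsilon> > 0\<close> by (auto simp: S_def)
  have domS: "Re ((poly b z / poly a z)\<^sup>2) > 0" "Re ((poly ?b2 z / poly ?a2 z)\<^sup>2) > 0"
    "Re ((poly ?b3 z / poly ?a3 z)\<^sup>2) > 0" "Re z > 1" if "z \<in> S" for z
    using dom[of z] that by (auto simp: S_def dist_commute)
  have log2: "log_interaction ?a2 ?b2 z = Ln (((z - 1) / (z - 2))\<^sup>2)" for z
    by (simp add: log_interaction_def)
  have q3: "poly ?b3 z / poly ?a3 z = (z - 1) * (z - 2) / (z\<^sup>2 - 3 * z + 3)" for z
    by (simp add: algebra_simps power2_eq_square)
  have log3: "log_interaction ?a3 ?b3 z = Ln (((z - 1) * (z - 2) / (z\<^sup>2 - 3 * z + 3))\<^sup>2)" for z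
    by (simp only: log_interaction_def q3)
  have indep: "\<not> (\<lambda>z. log_interaction ?a3 ?b3 z + k * log_interaction ?a2 ?b2 z) constant_on S" for k
    unfolding log2 log3
    by (rule path_log_derivatives_independent[OF S(1,3)])
      (use domS(2) in simp, use domS(3)[unfolded q3] in simp)
  have root: "\<exists>z\<in>S. \<exists>G. series_parallel G \<and> chromatic G z = 0"
  proof (cases "\<bar>y2\<bar> > 1")
    case True
    show ?thesis
      by (rule chromatic_root_from_two_graphs[OF realizable_path3 realizable_path2 S
          domS(3) domS(2) domS(4) val3 y3 val2 True indep])
  next
    case False
    have "y2 \<noteq> 1" "y2 \<noteq> - 1" using x by (auto simp: y2_def field_simps)
    with False have y2: "\<bar>y2\<bar> < 1" by linarith
    let ?c = "\<lambda>u. of_real (- ln (u\<^sup>2) / ln (y\<^sup>2)) :: complex"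
    have "y2\<^sup>2 < 1" using y2 by (simp add: abs_square_less_1)
    then have "ln (y2\<^sup>2) \<noteq> 0" using nz by simp
    moreover have "ln (y\<^sup>2) > 0"
      using ab(3) by (intro ln_gt_zero) (meson abs_square_le_1 not_less)
    ultimately have c2: "?c y2 \<noteq> 0" by simp
    have "\<not> (\<lambda>z. log_interaction ?a3 ?b3 z + ?c y3 * log_interaction a b z) constant_on S \<or>
        \<not> (\<lambda>z. log_interaction ?a2 ?b2 z + ?c y2 * log_interaction a b z) constant_on S"
    proof (rule ccontr)
      assume "\<not> ?thesis"
      then obtain d e where de:
        "\<And>z. z \<in> S \<Longrightarrow> log_interaction ?a3 ?b3 z + ?c y3 * log_interaction a b z = d"
        "\<And>z. z \<in> S \<Longrightarrow> log_interaction ?a2 ?b2 z + ?c y2 * log_interaction a b z = e"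
        unfolding constant_on_def by blast
      \<comment> \<open>Elimination of the common summand \<open>l\<close>.\<close>
      have "u + (- r / s) * v = d - r / s * e" if "u + r * l = d" "v + s * l = e" "s \<noteq> 0"
        for u v r s l :: complex
        using that(3) unfolding that(1,2)[symmetric] by (simp add: algebra_simps)
      from this[OF de c2] have "log_interaction ?a3 ?b3 z + (- ?c y3 / ?c y2) * log_interaction ?a2 ?b2 z
          = d - ?c y3 / ?c y2 * e" if "z \<in> S" for z
        using that by blast
      then show False using indep[of "- ?c y3 / ?c y2"] unfolding constant_on_def by blast
    qed
    then show ?thesis
    proof
      assume nonconst: "\<not> (\<lambda>z. log_interaction ?a3 ?b3 z + ?c y3 * log_interaction a b z) constant_on S"
      show ?thesis
        by (rule chromatic_root_from_two_graphs[OF realizable_path3 ab(1) S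
            domS(3) domS(1) domS(4) val3 y3 ab(2,3) nonconst])
    next
      assume nonconst: "\<not> (\<lambda>z. log_interaction ?a2 ?b2 z + ?c y2 * log_interaction a b z) constant_on S"
      show ?thesis
        by (rule chromatic_root_from_two_graphs[OF realizable_path2 ab(1) S
            domS(2) domS(1) domS(4) val2 y2 ab(2,3) nonconst])
    qed
  qed
  moreover have "cmod (z - of_real x) < \<epsilon>" if "z \<in> S" for z
    using that by (simp add: S_def dist_norm norm_minus_commute)
  ultimately show ?thesis by blast
qed

section \<open>Expanding graphs beyond 32/27\<close>

text \<open>The orbit of the single edge under doubling in parallel and then in series.\<close>

primrec interaction_orbit :: "real \<Rightarrow> nat \<Rightarrow> real" where
  "interaction_orbit q 0 = 0"
| "interaction_orbit q (Suc n) = (let y = interaction_orbit q n in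
     1 + (1 - y\<^sup>2)\<^sup>2 / (q - 2 * (1 - y\<^sup>2)))"

text \<open>Assume that the orbit stays in \<open>[-1, 1]\<close>. The denominator \<open>d\<close> must then be negative, as a positive one makes
  the next value greater than 1. With \<open>-2 \<le> d < 0\<close> and
  \<open>q - (1 - y)\<^sup>2 (1 + y) \<ge> q - 32/27\<close>, every step decreases \<open>y\<close> by at least \<open>(q - 32/27) / 2\<close>, which is
  impossible in a bounded set.\<close>

lemma interaction_orbit_escapes:
  assumes q: "32 / 27 < q" "q < 2"
    and pole: "\<And>n. q - 2 * (1 - (interaction_orbit q n)\<^sup>2) \<noteq> 0"
    and fixpoint: "\<And>n. interaction_orbit q n \<noteq> -1"
  shows "\<exists>n. \<bar>interaction_orbit q n\<bar> > 1"
proof (rule ccontr)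
  define y where "y = interaction_orbit q"
  define \<delta> where "\<delta> = q - 32 / 27"
  have \<delta>: "\<delta> > 0" using q by (simp add: \<delta>_def)
  assume "\<not> ?thesis"
  then have bound: "\<bar>y n\<bar> \<le> 1" for n by (simp add: y_def not_less)
  have "y n \<le> - real n * (\<delta> / 2)" for n
  proof (induction n)
    case (Suc n)
    define x where "x = y n"
    define d where "d = q - 2 * (1 - x\<^sup>2)"
    have step: "y (Suc n) = 1 + (1 - x\<^sup>2)\<^sup>2 / d" by (simp add: y_def x_def d_def Let_def)
    have x: "x \<le> 0" "-1 < x"
    proof -
      have "0 \<le> real n * (\<delta> / 2)" using \<delta> by simp
      then show "x \<le> 0" using Suc unfolding x_def by linarith
      show "-1 < x" using bound[of n] fixpoint[of n] unfolding x_def y_def by (auto simp: abs_le_iff)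
    qed
    have d0: "d \<noteq> 0" using pole[of n] by (simp add: d_def x_def y_def)
    have "x\<^sup>2 < 1" using x by (simp add: abs_square_less_1)
    have neg: "d < 0"
    proof (rule ccontr)
      assume "\<not> d < 0"
      then have "(1 - x\<^sup>2)\<^sup>2 / d > 0" using d0 \<open>x\<^sup>2 < 1\<close> by simp
      then show False using step bound[of "Suc n"] by linarith
    qed
    have "d \<ge> -2" using q by (simp add: d_def)
    have diff: "y (Suc n) - x = (1 - x) * (q - (1 - x)\<^sup>2 * (1 + x)) / d"
      unfolding step using d0 by (simp add: field_simps) (simp add: d_def algebra_simps power2_eq_square)
    \<comment> \<open>The double root of the difference is the maximum point \<open>-1/3\<close>.\<close>
    have "32 / 27 - (1 - x)\<^sup>2 * (1 + x) = (x + 1 / 3)\<^sup>2 * (5 / 3 - x)"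
      by (simp add: algebra_simps power2_eq_square)
    moreover have "0 \<le> (x + 1 / 3)\<^sup>2 * (5 / 3 - x)" using x by simp
    ultimately have "q - (1 - x)\<^sup>2 * (1 + x) \<ge> \<delta>" by (simp add: \<delta>_def)
    then have "(1 - x) * (q - (1 - x)\<^sup>2 * (1 + x)) \<ge> 1 * \<delta>"
      using x \<delta> by (intro mult_mono) auto
    then have num: "(1 - x) * (q - (1 - x)\<^sup>2 * (1 + x)) \<ge> \<delta>" by simp
    have "(1 - x) * (q - (1 - x)\<^sup>2 * (1 + x)) / d \<le> \<delta> / d"
      using num neg by (intro divide_right_mono_neg) auto
    also have "\<delta> / d \<le> \<delta> / (-2)"
      using \<delta> neg \<open>d \<ge> -2\<close> by (intro divide_left_mono) auto
    finally have "y (Suc n) - x \<le> - (\<delta> / 2)" using diff by simp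
    then show ?case using Suc unfolding x_def by (simp add: algebra_simps)
  qed (simp add: y_def)
  moreover obtain n where "real n * (\<delta> / 2) > 1"
    using \<delta> ex_less_of_nat_mult[of "\<delta> / 2" 1] by auto
  ultimately show False using bound[of n] by (smt (verit) mult_minus_left)
qed

text \<open>The weights of the graphs whose interactions form the orbit: squaring is parallel
  composition of two copies, and the pair is the series composition of two such graphs.\<close>

primrec doubling_weights :: "nat \<Rightarrow> complex poly \<times> complex poly" where
  "doubling_weights 0 = (1, 0)"
| "doubling_weights (Suc n) =
    (let a = (fst (doubling_weights n))\<^sup>2; b = (snd (doubling_weights n))\<^sup>2
     in (a * b + b * a + [:-2, 1:] * a * a, b * b + [:-1, 1:] * a * a))"

lemma realizable_doubling_weights:
  "realizable (fst (doubling_weights n)) (snd (doubling_weights n))"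
proof (induction n)
  case (Suc n)
  have sq: "realizable ((fst (doubling_weights n))\<^sup>2) ((snd (doubling_weights n))\<^sup>2)"
    using realizable_power[OF Suc] by simp
  show ?case using realizable_series[OF sq sq] by (simp add: Let_def)
qed (simp add: realizable_K2)

text \<open>A nonzero value at one point shows that the polynomials whose roots have to be avoided are not
  identically zero.\<close>

lemma doubling_weights_at_1:
  "(poly (fst (doubling_weights n)) 1)\<^sup>2 = 1 \<and> poly (snd (doubling_weights n)) 1 = 0"
  by (induction n) (simp_all add: Let_def)

text \<open>The weight \<open>a\<close> of the next graph is \<open>a\<^sup>4\<close> times the denominator of the orbit map, so this
  denominator does not vanish where the weights do not.\<close>

lemma interaction_doubling_weights:
  assumes "\<And>k. poly (fst (doubling_weights k)) (of_real x) \<noteq> 0"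
  shows "poly (snd (doubling_weights n)) (of_real x) =
      of_real (interaction_orbit x n) * poly (fst (doubling_weights n)) (of_real x)"
    and "x - 2 * (1 - (interaction_orbit x n)\<^sup>2) \<noteq> 0"
proof -
  let ?a = "\<lambda>n. poly (fst (doubling_weights n)) (of_real x)"
  let ?b = "\<lambda>n. poly (snd (doubling_weights n)) (of_real x)"
  let ?y = "interaction_orbit x"
  have den: "?a (Suc n) = (?a n) ^ 4 * of_real (x - 2 * (1 - (?y n)\<^sup>2))"
    if "?b n = of_real (?y n) * ?a n" for n
    using that by (simp add: Let_def algebra_simps power2_eq_square power4_eq_xxxx)
  have eq: "?b n = of_real (?y n) * ?a n" for n
  proof (induction n)
    case (Suc n)
    define y where "y = ?y n"
    define d where "d = x - 2 * (1 - y\<^sup>2)"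
    have d: "?a (Suc n) = (?a n) ^ 4 * of_real d"
      using den[OF Suc] unfolding y_def d_def .
    then have "d \<noteq> 0" using assms[of "Suc n"] by auto
    then have "?y (Suc n) * d = d + (1 - y\<^sup>2)\<^sup>2"
      unfolding interaction_orbit.simps Let_def y_def[symmetric] d_def[symmetric]
      by (simp add: field_simps)
    also have "\<dots> = y ^ 4 + x - 1"
      by (simp add: d_def algebra_simps power2_eq_square power4_eq_xxxx)
    finally have yd: "of_real (?y (Suc n)) * of_real d = (of_real y ^ 4 + of_real x - 1 :: complex)"
      by (simp flip: of_real_mult)
    have "?b (Suc n) = (?a n) ^ 4 * (of_real y ^ 4 + of_real x - 1)"
      using Suc[folded y_def] by (simp add: Let_def algebra_simps power2_eq_square power4_eq_xxxx)
    also have "\<dots> = of_real (?y (Suc n)) * ?a (Suc n)"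
      unfolding d yd[symmetric] by simp
    finally show ?case .
  qed simp
  then show "?b n = of_real (?y n) * ?a n" .
  show "x - 2 * (1 - (?y n)\<^sup>2) \<noteq> 0"
    using assms[of "Suc n"] den[OF eq] by (metis mult_zero_right of_real_0)
qed

text \<open>The excluded points are those where some interaction of the orbit has a pole or equals \<open>-1\<close>, which
  is mapped to the fixed point 1.\<close>

lemma countable_degenerate_points:
  "countable {x::real. \<exists>n. poly (fst (doubling_weights n)) (of_real x) = 0 \<or>
     poly (fst (doubling_weights n) + snd (doubling_weights n)) (of_real x) = 0}"
proof -
  have fin: "finite {x::real. poly p (of_real x) = 0}" if "poly p 1 \<noteq> 0" for p :: "complex poly"
  proof -
    have "finite {z. poly p z = 0}" using that by (intro poly_roots_finite) auto
    then have "finite (of_real -` {z. poly p z = 0} :: real set)"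
      by (rule finite_vimageI) (simp add: inj_of_real)
    then show ?thesis by (simp add: vimage_def)
  qed
  have "poly (fst (doubling_weights n)) 1 \<noteq> 0"
    "poly (fst (doubling_weights n) + snd (doubling_weights n)) 1 \<noteq> 0" for n
    using doubling_weights_at_1[of n] by auto
  then have "countable ({x::real. poly (fst (doubling_weights n)) (of_real x) = 0} \<union>
      {x. poly (fst (doubling_weights n) + snd (doubling_weights n)) (of_real x) = 0})" for n
    by (intro countable_Un countable_finite fin)
  then have "countable (\<Union>n. {x::real. poly (fst (doubling_weights n)) (of_real x) = 0} \<union>
      {x. poly (fst (doubling_weights n) + snd (doubling_weights n)) (of_real x) = 0})"
    by (intro countable_UN) auto
  then show ?thesis by (rule countable_subset[rotated]) auto
qed

text \<open>For \<open>x > 2\<close> the path with two edges expands, and for \<open>x < 2\<close> some graph in the orbit does.\<close>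

lemma exists_expanding_graph:
  assumes x: "x > 32 / 27" "x \<noteq> 2"
    and generic: "\<And>n. poly (fst (doubling_weights n)) (of_real x) \<noteq> 0"
      "\<And>n. poly (fst (doubling_weights n) + snd (doubling_weights n)) (of_real x) \<noteq> 0"
  shows "\<exists>a b y. realizable a b \<and> poly b (of_real x) / poly a (of_real x) = of_real y \<and> \<bar>y\<bar> > 1"
proof (cases "x > 2")
  case True
  then have "\<bar>(x - 1) / (x - 2)\<bar> > 1" by (simp add: abs_divide)
  moreover have "poly [:-1, 1:] (of_real x) / poly [:-2, 1:] (of_real x) = (of_real ((x - 1) / (x - 2)) :: complex)"
    by simp
  ultimately show ?thesis using realizable_path2 by blast
next
  case False
  note val = interaction_doubling_weights[OF generic(1)]
  have "interaction_orbit x n \<noteq> -1" for n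
    using val(1)[of n] generic(2)[of n] by auto
  then obtain n where "\<bar>interaction_orbit x n\<bar> > 1"
    using interaction_orbit_escapes[OF x(1)] val(2) x False by fastforce
  moreover have "poly (snd (doubling_weights n)) (of_real x) / poly (fst (doubling_weights n)) (of_real x)
      = of_real (interaction_orbit x n)"
    using val(1)[of n] generic(1)[of n] by simp
  ultimately show ?thesis using realizable_doubling_weights by blast
qed

section \<open>Density of chromatic roots\<close>

theorem theorem2:
  fixes q \<epsilon> :: real
  assumes "q > 32 / 27" and "\<epsilon> > 0"
  shows "\<exists>(q' :: complex) (G :: (nat, nat) two_terminal).
           cmod (q' - complex_of_real q) < \<epsilon> \<and> series_parallel G \<and> chromatic G q' = 0"
proof -
  \<comment> \<open>A nearby real point \<open>x\<close> replaces \<open>q\<close>, at which the orbit may be degenerate.\<close>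
  define degenerate where "degenerate = {x::real. \<exists>n. poly (fst (doubling_weights n)) (of_real x) = 0 \<or>
     poly (fst (doubling_weights n) + snd (doubling_weights n)) (of_real x) = 0}"
  have "countable (degenerate \<union> {2, 3 / 2})"
    using countable_degenerate_points unfolding degenerate_def by simp
  moreover have "uncountable {q<..<q + \<epsilon> / 2}" using assms by (simp add: uncountable_open_interval)
  ultimately have "\<not> {q<..<q + \<epsilon> / 2} \<subseteq> degenerate \<union> {2, 3 / 2}" using countable_subset by metis
  then obtain x where "x \<in> {q<..<q + \<epsilon> / 2}" and x: "x \<noteq> 2" "x \<noteq> 3 / 2" "x \<notin> degenerate"
    by blast
  then have near: "q < x" "x < q + \<epsilon> / 2" by simp_all
  have generic: "poly (fst (doubling_weights n)) (of_real x) \<noteq> 0"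
    "poly (fst (doubling_weights n) + snd (doubling_weights n)) (of_real x) \<noteq> 0" for n
    using x(3) unfolding degenerate_def by blast+
  obtain a b y where "realizable a b" "poly b (of_real x) / poly a (of_real x) = of_real y" "\<bar>y\<bar> > 1"
    using exists_expanding_graph[OF _ x(1) generic] near assms(1) by force
  then obtain z G where z: "cmod (z - of_real x) < \<epsilon> / 2" and G: "series_parallel G" "chromatic G z = 0"
    using chromatic_roots_near_expanding_point[of a b x y "\<epsilon> / 2"] x near assms by auto
  have "cmod (z - of_real q) \<le> cmod (z - of_real x) + cmod (of_real x - of_real q)"
    using norm_triangle_ineq[of "z - of_real x" "of_real x - of_real q"] by simp
  also have "cmod (of_real x - of_real q) = x - q"
    using near by (simp flip: of_real_diff)
  finally have "cmod (z - of_real q) < \<epsilon>" using z near by linarith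
  with G show ?thesis by blast
qed

end
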